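(* Every étale Boolean right restriction monoid $S$ is the companion of a unique (up to isomorphism) Boolean inverse monoid, namely $\mathsf{Inv}(S)$. That is, $S\cong\mathsf{Etale}(\mathsf{Inv}(S))$ as right restriction monoids, and if $B$ is any Boolean inverse monoid with $S\cong\mathsf{Etale}(B)$ then $B\cong\mathsf{Inv}(S)$.
   Context: A right restriction semigroup is a semigroup $S$ with a unary operation $a\mapsto a^*$ satisfying: (RR1) $(s^* )^*=s^*$; (RR2) $(s^*t^* )^*=s^*t^*$; (RR3) $s^*t^*=t^*s^*$; (RR4) $ss^*=s$; (RR5) $(st)^*=(s^*t)^*$; (RR6) $t^*s=s(ts)^*$. Elements with $a^*=a$ are projections; $\mathsf{Proj}(S)$ is the set of them. The natural partial order is $a\le b$ iff $a=ba^*$; joins refer to it. Elements $a,b$ are left-compatible, $a\sim_l b$, if $ab^*=ba^*$; a set is left-compatible if its elements are pairwise so. A right restriction monoid is complete if every left-compatible subset has a join and $(\bigvee_i a_i)b=\bigvee_i a_ib$ for all such joins. It is Boolean if every pair of left-compatible elements has a join, multiplication distributes from the right over such binary joins, and $\mathsf{Proj}(S)$ is a Boolean algebra whose bottom $0$ is the zero of the monoid. An element $a$ is a partial unit if there is $b$ with $ba=a^*$ and $ab=b^*$; $\mathsf{Inv}(S)$ is the set of partial units; it is an inverse monoid with idempotents $\mathsf{Proj}(S)$, and is a Boolean inverse monoid when $S$ is Boolean. A Boolean right restriction monoid is étale if every element is a join of a finite number of partial units. An inverse monoid is a right restriction monoid with $a^*=a^{-1}a$. In it, $a,b$ are compatible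 if $ab^{-1}$ and $a^{-1}b$ are idempotents. A Boolean inverse monoid is an inverse monoid with zero in which every pair of compatible elements has a join, multiplication distributes over such joins, and the idempotents form a Boolean algebra. Construction of the companion $\mathsf{Etale}(B)$ of a Boolean inverse monoid $B$: a subset of $B$ is acceptable if it is a left-compatible order ideal (down-closed set). $\mathsf{R}(B)$ is the set of all acceptable subsets; under $XY=\{xy: x\in X,y\in Y\}$ and $X^*=\{x^*:x\in X\}$ it is a complete right restriction monoid whose natural partial order is inclusion. For $X\in\mathsf{R}(B)$ let $\nu(X)=X^\vee$ be the set of all joins of finite compatible subsets of $X$ (including the empty join $0$). Put $\mathsf{R}(B)_\nu=\{X\in\mathsf{R}(B):\nu(X)=X\}$ with product $X\cdot Y=\nu(XY)$ and star $X^\circ=\nu(X^* )$; this is a complete right restriction monoid whose natural partial order is inclusion and whose joins are $\bigsqcup_i X_i=\nu(\bigcup_i X_i)$. An element $a$ of a complete right restriction monoid is finite if whenever $a\le\bigvee_{i\in I}a_i$ there is a finite $F\subseteq I$ with $a\le\bigvee_{i\in F}a_i$. Then $\mathsf{Etale}(B)$ is the set of finite elements of $\mathsf{R}(B)_\nu$ with the inherited operations $\cdot$ and $\circ$; it is an étale Boolean right restriction monoid. "$S$ is the companion of $B$" is understood up to isomorphism of right restriction monoids. *)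

theory Defs
  imports "HOL-Algebra.Coset" "HOL-Algebra.Lattice"
begin

section \<open>Right restriction monoids\<close>

record 'a rr_monoid = "'a monoid" +
  star :: "'a \<Rightarrow> 'a" (\<open>(_\<^sup>\<star>\<index>)\<close> [1000] 999)

locale right_restriction_monoid = monoid S for S (structure) +
  assumes star_closed: "s \<in> carrier S \<Longrightarrow> s\<^sup>\<star> \<in> carrier S"
    and RR1: "s \<in> carrier S \<Longrightarrow> (s\<^sup>\<star>)\<^sup>\<star> = s\<^sup>\<star>"
    and RR2: "\<lbrakk>s \<in> carrier S; t \<in> carrier S\<rbrakk> \<Longrightarrow> (s\<^sup>\<star> \<otimes> t\<^sup>\<star>)\<^sup>\<star> = s\<^sup>\<star> \<otimes> t\<^sup>\<star>"
    and RR3: "\<lbrakk>s \<in> carrier S; t \<in> carrier S\<rbrakk> \<Longrightarrow> s\<^sup>\<star> \<otimes> t\<^sup>\<star> = t\<^sup>\<star> \<otimes> s\<^sup>\<star>"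
    and RR4: "s \<in> carrier S \<Longrightarrow> s \<otimes> s\<^sup>\<star> = s"
    and RR5: "\<lbrakk>s \<in> carrier S; t \<in> carrier S\<rbrakk> \<Longrightarrow> (s \<otimes> t)\<^sup>\<star> = (s\<^sup>\<star> \<otimes> t)\<^sup>\<star>"
    and RR6: "\<lbrakk>s \<in> carrier S; t \<in> carrier S\<rbrakk> \<Longrightarrow> t\<^sup>\<star> \<otimes> s = s \<otimes> (t \<otimes> s)\<^sup>\<star>"

definition Proj :: "('a, 'm) rr_monoid_scheme \<Rightarrow> 'a set"
  where "Proj S = {a \<in> carrier S. a\<^sup>\<star>\<^bsub>S\<^esub> = a}"

definition nat_order :: "('a, 'm) rr_monoid_scheme \<Rightarrow> 'a gorder"
  where "nat_order S = \<lparr>carrier = carrier S, eq = (=), le = (\<lambda>a b. a = b \<otimes>\<^bsub>S\<^esub> a\<^sup>\<star>\<^bsub>S\<^esub>)\<rparr>"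

definition is_join :: "('a, 'm) rr_monoid_scheme \<Rightarrow> 'a set \<Rightarrow> 'a \<Rightarrow> bool"
  where "is_join S A j \<longleftrightarrow> A \<subseteq> carrier S \<and> least (nat_order S) j (Upper (nat_order S) A)"

definition left_compatible :: "('a, 'm) rr_monoid_scheme \<Rightarrow> 'a \<Rightarrow> 'a \<Rightarrow> bool"
  where "left_compatible S a b \<longleftrightarrow> a \<otimes>\<^bsub>S\<^esub> b\<^sup>\<star>\<^bsub>S\<^esub> = b \<otimes>\<^bsub>S\<^esub> a\<^sup>\<star>\<^bsub>S\<^esub>"

definition is_zero :: "('a, 'm) monoid_scheme \<Rightarrow> 'a \<Rightarrow> bool"
  where "is_zero M z \<longleftrightarrow>
    z \<in> carrier M \<and> (\<forall>x\<in>carrier M. z \<otimes>\<^bsub>M\<^esub> x = z \<and> x \<otimes>\<^bsub>M\<^esub> z = z)"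

locale boolean_algebra_order = bounded_lattice L for L (structure) +
  assumes meet_join_distrib:
      "\<lbrakk>x \<in> carrier L; y \<in> carrier L; z \<in> carrier L\<rbrakk>
        \<Longrightarrow> x \<sqinter> (y \<squnion> z) = (x \<sqinter> y) \<squnion> (x \<sqinter> z)"
    and complement_exists:
      "x \<in> carrier L \<Longrightarrow> \<exists>y\<in>carrier L. x \<sqinter> y = \<bottom> \<and> x \<squnion> y = \<top>"

locale boolean_rr_monoid = right_restriction_monoid +
  assumes binary_join_exists:
      "\<lbrakk>a \<in> carrier S; b \<in> carrier S; left_compatible S a b\<rbrakk> \<Longrightarrow> \<exists>j. is_join S {a, b} j"
    and binary_join_mult_right:
      "\<lbrakk>a \<in> carrier S; b \<in> carrier S; c \<in> carrier S; left_compatible S a b; is_join S {a, b} j\<rbrakk>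
        \<Longrightarrow> is_join S {a \<otimes> c, b \<otimes> c} (j \<otimes> c)"
    and Proj_boolean: "boolean_algebra_order ((nat_order S)\<lparr>carrier := Proj S\<rparr>)"
    and bottom_zero: "is_zero S (\<bottom>\<^bsub>(nat_order S)\<lparr>carrier := Proj S\<rparr>\<^esub>)"

definition partial_units :: "('a, 'm) rr_monoid_scheme \<Rightarrow> 'a set"
  where "partial_units S =
    {a \<in> carrier S. \<exists>b\<in>carrier S. b \<otimes>\<^bsub>S\<^esub> a = a\<^sup>\<star>\<^bsub>S\<^esub> \<and> a \<otimes>\<^bsub>S\<^esub> b = b\<^sup>\<star>\<^bsub>S\<^esub>}"

definition Inv :: "('a, 'm) rr_monoid_scheme \<Rightarrow> 'a monoid"
  where "Inv S = \<lparr>carrier = partial_units S, mult = mult S, one = one S\<rparr>"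

locale etale_boolean_rr_monoid = boolean_rr_monoid +
  assumes etale: "a \<in> carrier S \<Longrightarrow> \<exists>F. finite F \<and> F \<subseteq> partial_units S \<and> is_join S F a"

text \<open>A multiplicative bijection between monoids automatically preserves the identity,
  so it is not required separately (as in \<^const>\<open>iso\<close>).\<close>

definition rr_iso :: "('a, 'm) rr_monoid_scheme \<Rightarrow> ('b, 'n) rr_monoid_scheme \<Rightarrow> ('a \<Rightarrow> 'b) set"
  where "rr_iso S T = {h \<in> iso S T. \<forall>a\<in>carrier S. h (a\<^sup>\<star>\<^bsub>S\<^esub>) = (h a)\<^sup>\<star>\<^bsub>T\<^esub>}"

definition rr_isomorphic :: "('a, 'm) rr_monoid_scheme \<Rightarrow> ('b, 'n) rr_monoid_scheme \<Rightarrow> bool"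
    (infixr \<open>\<cong>\<^sub>r\<^sub>r\<close> 60)
  where "S \<cong>\<^sub>r\<^sub>r T \<longleftrightarrow> rr_iso S T \<noteq> {}"


section \<open>Boolean inverse monoids\<close>

locale inverse_monoid = monoid B for B (structure) +
  assumes unique_inverse:
    "a \<in> carrier B \<Longrightarrow> \<exists>!b. b \<in> carrier B \<and> a \<otimes> b \<otimes> a = a \<and> b \<otimes> a \<otimes> b = b"

text \<open>This is the inverse in the sense of inverse semigroups; \<^const>\<open>m_inv\<close> is only meaningful
  for units.\<close>

definition ginv :: "('b, 'm) monoid_scheme \<Rightarrow> 'b \<Rightarrow> 'b"
  where "ginv B a =
    (THE b. b \<in> carrier B \<and> a \<otimes>\<^bsub>B\<^esub> b \<otimes>\<^bsub>B\<^esub> a = a \<and> b \<otimes>\<^bsub>B\<^esub> a \<otimes>\<^bsub>B\<^esub> b = b)"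

definition idempotents :: "('b, 'm) monoid_scheme \<Rightarrow> 'b set"
  where "idempotents B = {e \<in> carrier B. e \<otimes>\<^bsub>B\<^esub> e = e}"

definition to_rr :: "('b, 'm) monoid_scheme \<Rightarrow> 'b rr_monoid"
  where "to_rr B = \<lparr>carrier = carrier B, mult = mult B, one = one B,
    star = (\<lambda>a. ginv B a \<otimes>\<^bsub>B\<^esub> a)\<rparr>"

definition compatible :: "('b, 'm) monoid_scheme \<Rightarrow> 'b \<Rightarrow> 'b \<Rightarrow> bool"
  where "compatible B a b \<longleftrightarrow>
    a \<otimes>\<^bsub>B\<^esub> ginv B b \<in> idempotents B \<and> ginv B a \<otimes>\<^bsub>B\<^esub> b \<in> idempotents B"

locale boolean_inverse_monoid = inverse_monoid +
  assumes zero_exists: "\<exists>z. is_zero B z"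
    and binary_join_exists:
      "\<lbrakk>a \<in> carrier B; b \<in> carrier B; compatible B a b\<rbrakk> \<Longrightarrow> \<exists>j. is_join (to_rr B) {a, b} j"
    and binary_join_mult_right:
      "\<lbrakk>a \<in> carrier B; b \<in> carrier B; c \<in> carrier B; compatible B a b; is_join (to_rr B) {a, b} j\<rbrakk>
        \<Longrightarrow> is_join (to_rr B) {a \<otimes> c, b \<otimes> c} (j \<otimes> c)"
    and binary_join_mult_left:
      "\<lbrakk>a \<in> carrier B; b \<in> carrier B; c \<in> carrier B; compatible B a b; is_join (to_rr B) {a, b} j\<rbrakk>
        \<Longrightarrow> is_join (to_rr B) {c \<otimes> a, c \<otimes> b} (c \<otimes> j)"
    and idempotents_boolean:
      "boolean_algebra_order ((nat_order (to_rr B))\<lparr>carrier := idempotents B\<rparr>)"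


section \<open>The companion of a Boolean inverse monoid\<close>

definition acceptable :: "('b, 'm) monoid_scheme \<Rightarrow> 'b set \<Rightarrow> bool"
  where "acceptable B X \<longleftrightarrow> X \<subseteq> carrier B
    \<and> (\<forall>x\<in>X. \<forall>y\<in>X. left_compatible (to_rr B) x y)
    \<and> (\<forall>x\<in>X. \<forall>y\<in>carrier B. y \<sqsubseteq>\<^bsub>nat_order (to_rr B)\<^esub> x \<longrightarrow> y \<in> X)"

text \<open>The identity of \<open>R(B)\<close> is the order ideal generated by the identity of \<open>B\<close>,
  which is the set of all idempotents.\<close>

definition R_monoid :: "('b, 'm) monoid_scheme \<Rightarrow> 'b set rr_monoid"
  where "R_monoid B = \<lparr>carrier = {X. acceptable B X}, mult = set_mult B, one = idempotents B,
    star = (\<lambda>X. star (to_rr B) ` X)\<rparr>"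

definition nucleus :: "('b, 'm) monoid_scheme \<Rightarrow> 'b set \<Rightarrow> 'b set"
  where "nucleus B X = {j. \<exists>F\<subseteq>X. finite F \<and> (\<forall>x\<in>F. \<forall>y\<in>F. compatible B x y)
    \<and> is_join (to_rr B) F j}"

definition R_nu_monoid :: "('b, 'm) monoid_scheme \<Rightarrow> 'b set rr_monoid"
  where "R_nu_monoid B = \<lparr>carrier = {X \<in> carrier (R_monoid B). nucleus B X = X},
    mult = (\<lambda>X Y. nucleus B (X \<otimes>\<^bsub>R_monoid B\<^esub> Y)),
    one = \<one>\<^bsub>R_monoid B\<^esub>,
    star = (\<lambda>X. nucleus B (X\<^sup>\<star>\<^bsub>R_monoid B\<^esub>))\<rparr>"

text \<open>Families are represented by their sets of members, which have the same joins.\<close>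

definition finite_elements :: "('a, 'm) rr_monoid_scheme \<Rightarrow> 'a set"
  where "finite_elements S = {a \<in> carrier S.
    \<forall>A j. is_join S A j \<and> a \<sqsubseteq>\<^bsub>nat_order S\<^esub> j
      \<longrightarrow> (\<exists>F\<subseteq>A. finite F \<and> (\<exists>k. is_join S F k \<and> a \<sqsubseteq>\<^bsub>nat_order S\<^esub> k))}"

definition Etale :: "('b, 'm) monoid_scheme \<Rightarrow> 'b set rr_monoid"
  where "Etale B = (R_nu_monoid B)\<lparr>carrier := finite_elements (R_nu_monoid B)\<rparr>"

end

theory Submission
  imports Defs
begin

text \<open>
  Let \<open>S\<close> be an etale Boolean right restriction monoid and \<open>U\<close> its monoid of partial units.
  An element of \<open>S\<close> is a finite join of partial units, so it is determined by the set of
  all partial units below it. This set is left-compatible, down-closed and closed under those finite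
  joins that exist in \<open>U\<close>: it is an element of \<open>R(U)\<close> fixed by the nucleus. The map
  \<open>units_below\<close> sending \<open>s\<close> to this set is the isomorphism of \<open>S\<close> with the
  companion of \<open>U\<close>; the second half of the theorem comes from the map sending \<open>b\<close>
  to its principal ideal \<open>\<down>b\<close>, an isomorphism of any Boolean inverse monoid with the partial
  units of its companion.

  Both arguments calculate with finite joins of elements that have a common upper bound. In
  \<open>S\<close>, and in a Boolean inverse monoid regarded as a right restriction monoid, such joins
  exist and multiplication distributes over them on both sides; the locale
  \<open>finite_join_rr_monoid\<close> records this and the zero, and arbitrary finite joins are treated
  there. In \<open>S\<close> distributivity from the left is a consequence of distributivity from the
  right, because the star preserves joins (\<open>binary_join_mult_left\<close>). It yields that the join
  of two compatible partial units \<open>a\<close> and \<open>b\<close> is a partial unit: its inverse is the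
  join of the inverses, as all mixed products are projections
  (\<open>join_compatible_partial_units\<close>). Hence \<open>U\<close> is a Boolean inverse monoid.

  For a Boolean inverse monoid \<open>B\<close>, the order of \<open>R(B)\<^sub>\<nu>\<close> is inclusion, and a member is
  finite in the sense of the companion exactly when it is the least member containing some finite
  set (\<open>finite_elements_R_nu_iff\<close>). Applied to \<open>U\<close>, such a generating set is a finite
  left-compatible set of partial units; its join \<open>s\<close> in \<open>S\<close> satisfies
  \<open>X = units_below S s\<close>, which gives surjectivity. Applied to a partial unit \<open>X\<close> of the
  companion of \<open>B\<close> with inverse \<open>Y\<close>, one shows that the inverses of the members of
  \<open>X\<close> lie in \<open>Y\<close> (\<open>partial_unit_ginv_mem\<close>). So \<open>X\<close> is compatible and
  not merely left-compatible, the generating set has a join \<open>b\<close> in \<open>B\<close>, and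
  \<open>X = \<down>b\<close>. Finally, an isomorphism of right restriction monoids restricts to the partial
  units, so that \<open>S \<cong> Etale B\<close> forces \<open>B \<cong> Inv (Etale B) \<cong> Inv S\<close>.
\<close>

section \<open>The natural order and joins in right restriction monoids\<close>

abbreviation below :: "('a, 'm) rr_monoid_scheme \<Rightarrow> 'a \<Rightarrow> 'a \<Rightarrow> bool"
    (\<open>(_/ \<preceq>\<index> _)\<close> [51, 51] 50)
  where "a \<preceq>\<^bsub>S\<^esub> b \<equiv> a \<sqsubseteq>\<^bsub>nat_order S\<^esub> b"

lemma carrier_nat_order [simp]: "carrier (nat_order S) = carrier S"
  by (simp add: nat_order_def)

lemma nat_le_iff: "a \<preceq>\<^bsub>S\<^esub> b \<longleftrightarrow> a = b \<otimes>\<^bsub>S\<^esub> a\<^sup>\<star>\<^bsub>S\<^esub>"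
  by (simp add: nat_order_def)

lemma is_join_iff:
  "is_join S A j \<longleftrightarrow> A \<subseteq> carrier S \<and> j \<in> carrier S \<and> (\<forall>a\<in>A. a \<preceq>\<^bsub>S\<^esub> j) \<and>
    (\<forall>u\<in>carrier S. (\<forall>a\<in>A. a \<preceq>\<^bsub>S\<^esub> u) \<longrightarrow> j \<preceq>\<^bsub>S\<^esub> u)"
  unfolding is_join_def least_def Upper_def by (simp add: subset_iff) blast

context right_restriction_monoid
begin

lemma belowD: "a \<preceq> b \<Longrightarrow> b \<otimes> a\<^sup>\<star> = a"
  by (simp add: nat_le_iff)

lemma star_idem: "s \<in> carrier S \<Longrightarrow> s\<^sup>\<star> \<otimes> s\<^sup>\<star> = s\<^sup>\<star>"
  using RR4[of "s\<^sup>\<star>"] by (simp add: star_closed RR1)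

lemma star_mult_star: "\<lbrakk>s \<in> carrier S; t \<in> carrier S\<rbrakk> \<Longrightarrow> (s \<otimes> t\<^sup>\<star>)\<^sup>\<star> = s\<^sup>\<star> \<otimes> t\<^sup>\<star>"
  using RR5[of s "t\<^sup>\<star>"] RR2[of s t] by (simp add: star_closed)

lemma star_mult_absorb:
  assumes "s \<in> carrier S" "t \<in> carrier S"
  shows "(s \<otimes> t)\<^sup>\<star> \<otimes> t\<^sup>\<star> = (s \<otimes> t)\<^sup>\<star>"
  using star_mult_star[of "s \<otimes> t" t] assms by (simp add: m_assoc star_closed RR4)

lemma star_one: "\<one>\<^sup>\<star> = \<one>"
  using RR4[of \<one>] by (simp add: star_closed)

lemma mult_star_below:
  assumes "b \<in> carrier S" "e \<in> carrier S"
  shows "b \<otimes> e\<^sup>\<star> \<preceq> b"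
proof -
  have "b \<otimes> (b \<otimes> e\<^sup>\<star>)\<^sup>\<star> = b \<otimes> b\<^sup>\<star> \<otimes> e\<^sup>\<star>"
    using assms by (simp add: star_mult_star star_closed m_assoc)
  then show ?thesis using assms by (simp add: RR4 nat_le_iff)
qed

lemma below_refl: "a \<in> carrier S \<Longrightarrow> a \<preceq> a"
  by (simp add: nat_le_iff RR4)

lemma below_trans:
  assumes "a \<preceq> b" "b \<preceq> c" "a \<in> carrier S" "b \<in> carrier S" "c \<in> carrier S"
  shows "a \<preceq> c"
proof -
  have "a = c \<otimes> (b\<^sup>\<star> \<otimes> a\<^sup>\<star>)\<^sup>\<star>"
    using belowD[OF assms(1)] belowD[OF assms(2)] assms(3-5)
    by (metis RR2 m_assoc star_closed)
  then show ?thesis using mult_star_below[of c "b\<^sup>\<star> \<otimes> a\<^sup>\<star>"] assms by (simp add: star_closed)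
qed

lemma below_antisym:
  assumes "a \<preceq> b" "b \<preceq> a" "a \<in> carrier S" "b \<in> carrier S"
  shows "a = b"
proof -
  have "a = a \<otimes> (b\<^sup>\<star> \<otimes> a\<^sup>\<star>)"
    using belowD[OF assms(1)] belowD[OF assms(2)] assms(3,4) by (metis m_assoc star_closed)
  also have "\<dots> = a \<otimes> a\<^sup>\<star> \<otimes> b\<^sup>\<star>" using assms(3,4) by (simp add: RR3 m_assoc star_closed)
  also have "\<dots> = b" using assms(3,4) belowD[OF assms(2)] by (simp add: RR4)
  finally show ?thesis .
qed

lemma star_mono:
  assumes "a \<preceq> b" "a \<in> carrier S" "b \<in> carrier S"
  shows "a\<^sup>\<star> \<preceq> b\<^sup>\<star>"
  using star_mult_star[of b a] belowD[OF assms(1)] assms(2,3) by (simp add: nat_le_iff RR1)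

text \<open>Left translation is monotone by associativity. For right translation, (RR6) moves the domain
  \<open>a\<^sup>\<star>\<close> past \<open>c\<close>, where it becomes a restriction of \<open>a \<otimes> c\<close>.\<close>

lemma mult_mono_below:
  assumes "a \<preceq> b" "c \<preceq> d"
    and [simp]: "a \<in> carrier S" "b \<in> carrier S" "c \<in> carrier S" "d \<in> carrier S"
  shows "a \<otimes> c \<preceq> b \<otimes> d"
proof -
  have "a \<otimes> c = b \<otimes> (a\<^sup>\<star> \<otimes> c)"
    using belowD[OF assms(1)] by (metis assms(3-5) m_assoc star_closed)
  also have "\<dots> = b \<otimes> (c \<otimes> (a \<otimes> c)\<^sup>\<star>)" by (simp add: RR6)
  also have "\<dots> = b \<otimes> (d \<otimes> c\<^sup>\<star> \<otimes> (a \<otimes> c)\<^sup>\<star>)" using belowD[OF assms(2)] by simp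
  also have "\<dots> = b \<otimes> d \<otimes> (c\<^sup>\<star> \<otimes> (a \<otimes> c)\<^sup>\<star>)" by (simp add: m_assoc star_closed)
  also have "c\<^sup>\<star> \<otimes> (a \<otimes> c)\<^sup>\<star> = (a \<otimes> c)\<^sup>\<star>"
    using star_mult_absorb[of a c] RR3[of c "a \<otimes> c"] by simp
  finally show ?thesis by (simp add: nat_le_iff)
qed

lemma below_one_iff: "a \<in> carrier S \<Longrightarrow> a \<preceq> \<one> \<longleftrightarrow> a\<^sup>\<star> = a"
  by (auto simp: nat_le_iff star_closed)

text \<open>An element below a projection is a product of two projections.\<close>

lemma below_star_imp_star_eq:
  assumes "a \<preceq> b\<^sup>\<star>" "a \<in> carrier S" "b \<in> carrier S"
  shows "a\<^sup>\<star> = a"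
  using belowD[OF assms(1)] assms(2,3) by (metis RR2)

text \<open>Restrictions of one and the same element are ordered like their domains.\<close>

lemma below_if_star_below:
  assumes "a \<preceq> u" "b \<preceq> u" "a\<^sup>\<star> \<preceq> b\<^sup>\<star>"
    and "a \<in> carrier S" "b \<in> carrier S" "u \<in> carrier S"
  shows "a \<preceq> b"
proof -
  have "b \<otimes> a\<^sup>\<star> = u \<otimes> (b\<^sup>\<star> \<otimes> a\<^sup>\<star>)"
    using belowD[OF assms(2)] assms(4-6) by (metis m_assoc star_closed)
  also have "b\<^sup>\<star> \<otimes> a\<^sup>\<star> = a\<^sup>\<star>" using belowD[OF assms(3)] assms(4) by (simp add: RR1)
  finally show ?thesis using belowD[OF assms(1)] by (simp add: nat_le_iff)
qed

lemma bounded_imp_left_compatible: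
  assumes "a \<preceq> u" "b \<preceq> u" "a \<in> carrier S" "b \<in> carrier S" "u \<in> carrier S"
  shows "left_compatible S a b"
  unfolding left_compatible_def
  using belowD[OF assms(1)] belowD[OF assms(2)] RR3[of a b] assms(3-5)
  by (metis m_assoc star_closed)

lemma left_compatible_sym: "left_compatible S a b \<Longrightarrow> left_compatible S b a"
  by (simp add: left_compatible_def)

lemma left_compatible_star:
  "\<lbrakk>a \<in> carrier S; b \<in> carrier S\<rbrakk> \<Longrightarrow> left_compatible S (a\<^sup>\<star>) (b\<^sup>\<star>)"
  by (simp add: left_compatible_def RR1 RR3)

lemma is_join_carrier: "is_join S A j \<Longrightarrow> j \<in> carrier S"
  and is_join_subset: "is_join S A j \<Longrightarrow> A \<subseteq> carrier S"
  and is_join_upper: "is_join S A j \<Longrightarrow> a \<in> A \<Longrightarrow> a \<preceq> j"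
  and is_join_least:
    "is_join S A j \<Longrightarrow> u \<in> carrier S \<Longrightarrow> (\<And>a. a \<in> A \<Longrightarrow> a \<preceq> u) \<Longrightarrow> j \<preceq> u"
  by (auto simp: is_join_iff)

lemma is_joinI:
  assumes "A \<subseteq> carrier S" "j \<in> carrier S" "\<And>a. a \<in> A \<Longrightarrow> a \<preceq> j"
    and "\<And>u. u \<in> carrier S \<Longrightarrow> (\<And>a. a \<in> A \<Longrightarrow> a \<preceq> u) \<Longrightarrow> j \<preceq> u"
  shows "is_join S A j"
  using assms by (auto simp: is_join_iff)

lemma is_join_unique: "is_join S A j \<Longrightarrow> is_join S A k \<Longrightarrow> j = k"
  by (meson below_antisym is_join_carrier is_join_least is_join_upper)

lemma is_join_single: "a \<in> carrier S \<Longrightarrow> is_join S {a} a"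
  by (auto intro!: is_joinI simp: below_refl)

lemma is_join_insert:
  assumes "is_join S F k" "is_join S {a, k} j"
  shows "is_join S (insert a F) j"
proof (rule is_joinI)
  have c: "a \<in> carrier S" "k \<in> carrier S" "j \<in> carrier S" "F \<subseteq> carrier S"
    using assms is_join_subset is_join_carrier by blast+
  then show "insert a F \<subseteq> carrier S" "j \<in> carrier S" by auto
  have "a \<preceq> j" "k \<preceq> j" using assms(2) by (auto intro: is_join_upper)
  then show "x \<preceq> j" if "x \<in> insert a F" for x
    using that c is_join_upper[OF assms(1)] below_trans[of x k j] by auto
  show "j \<preceq> u" if "u \<in> carrier S" "\<And>x. x \<in> insert a F \<Longrightarrow> x \<preceq> u" for u
    using that is_join_least[OF assms(1), of u] is_join_least[OF assms(2), of u] by auto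
qed

lemma is_join_insertD:
  assumes "is_join S F k" "is_join S (insert a F) j"
  shows "is_join S {a, k} j"
proof (rule is_joinI)
  have c: "a \<in> carrier S" "k \<in> carrier S" "j \<in> carrier S" "F \<subseteq> carrier S"
    using assms is_join_subset is_join_carrier by blast+
  then show "{a, k} \<subseteq> carrier S" "j \<in> carrier S" by auto
  have "a \<preceq> j" "k \<preceq> j"
    using assms(2) is_join_least[OF assms(1) c(3)] by (auto intro: is_join_upper)
  then show "x \<preceq> j" if "x \<in> {a, k}" for x using that by auto
  show "j \<preceq> u" if "u \<in> carrier S" "\<And>x. x \<in> {a, k} \<Longrightarrow> x \<preceq> u" for u
  proof (rule is_join_least[OF assms(2) that(1)])
    show "x \<preceq> u" if "x \<in> insert a F" for x
      using that \<open>\<And>x. x \<in> {a, k} \<Longrightarrow> x \<preceq> u\<close> \<open>u \<in> carrier S\<close> c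
        is_join_upper[OF assms(1)] below_trans[of x k u] by auto
  qed
qed

lemma is_join_UN:
  assumes j: "is_join S (h ` I) j" and h: "\<And>i. i \<in> I \<Longrightarrow> is_join S (G i) (h i)"
  shows "is_join S (\<Union>i\<in>I. G i) j"
proof (rule is_joinI)
  have c: "h i \<in> carrier S" "G i \<subseteq> carrier S" if "i \<in> I" for i
    using h[OF that] is_join_carrier is_join_subset by blast+
  then show "(\<Union>i\<in>I. G i) \<subseteq> carrier S" by auto
  show jc: "j \<in> carrier S" using j by (rule is_join_carrier)
  show "x \<preceq> j" if "x \<in> (\<Union>i\<in>I. G i)" for x
  proof -
    obtain i where i: "i \<in> I" "x \<in> G i" using \<open>x \<in> (\<Union>i\<in>I. G i)\<close> by blast
    show ?thesis
      using below_trans[OF is_join_upper[OF h[OF i(1)] i(2)] is_join_upper[OF j, of "h i"]] i c jc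
      by blast
  qed
  show "j \<preceq> u" if "u \<in> carrier S" "\<And>x. x \<in> (\<Union>i\<in>I. G i) \<Longrightarrow> x \<preceq> u" for u
  proof (rule is_join_least[OF j that(1)])
    fix a assume "a \<in> h ` I"
    then obtain i where i: "i \<in> I" "a = h i" by blast
    have "h i \<preceq> u" using that(2) i(1) by (intro is_join_least[OF h[OF i(1)] that(1)]) auto
    then show "a \<preceq> u" using i by simp
  qed
qed

text \<open>If \<open>e\<close> is the join of the domains, then \<open>j \<otimes> e\<close> is still an upper bound of
  \<open>F\<close>, so restricting \<open>j\<close> to \<open>e\<close> changes nothing.\<close>

lemma star_of_join:
  assumes j: "is_join S F j" and e: "is_join S (star S ` F) e"
  shows "j\<^sup>\<star> = e"
proof -
  have c [simp]: "j \<in> carrier S" "e \<in> carrier S" and F: "F \<subseteq> carrier S"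
    using j e is_join_carrier is_join_subset by blast+
  have ej: "e \<preceq> j\<^sup>\<star>"
    using is_join_upper[OF j] F by (intro is_join_least[OF e]) (auto simp: star_closed intro!: star_mono)
  then have ee: "e\<^sup>\<star> = e" by (intro below_star_imp_star_eq[of e j]) auto
  have "j \<preceq> j \<otimes> e"
  proof (rule is_join_least[OF j])
    fix a assume a: "a \<in> F"
    have "j \<otimes> e \<otimes> a\<^sup>\<star> = j \<otimes> a\<^sup>\<star>"
      using belowD[OF is_join_upper[OF e, of "a\<^sup>\<star>"]] a F by (simp add: subset_iff m_assoc star_closed RR1)
    also have "\<dots> = a" using belowD[OF is_join_upper[OF j a]] .
    finally show "a \<preceq> j \<otimes> e" by (simp add: nat_le_iff)
  qed simp
  then have "j \<otimes> e \<otimes> j\<^sup>\<star> = j" by (rule belowD)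
  moreover have "j \<otimes> e \<otimes> j\<^sup>\<star> = j \<otimes> j\<^sup>\<star> \<otimes> e"
    using RR3[of e j] ee by (simp add: m_assoc star_closed)
  ultimately have "j \<otimes> e = j" by (simp add: RR4)
  then have "j\<^sup>\<star> \<otimes> e = j\<^sup>\<star>" using star_mult_star[of j e] ee by simp
  moreover have "j\<^sup>\<star> \<otimes> e = e" using belowD[OF ej] ee by simp
  ultimately show ?thesis by simp
qed

end

text \<open>The common ground of Boolean right restriction monoids and Boolean inverse monoids. The two
  theories differ in which pairs must have a join; pairs with a common upper bound have
  one in both, and any pair that has a join is of this kind.\<close>

locale finite_join_rr_monoid = right_restriction_monoid +
  assumes bounded_join:
      "\<lbrakk>a \<in> carrier S; b \<in> carrier S; u \<in> carrier S; a \<preceq> u; b \<preceq> u\<rbrakk> \<Longrightarrow> \<exists>j. is_join S {a, b} j"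
    and join_mult_right:
      "\<lbrakk>c \<in> carrier S; is_join S {a, b} j\<rbrakk> \<Longrightarrow> is_join S {a \<otimes> c, b \<otimes> c} (j \<otimes> c)"
    and join_mult_left:
      "\<lbrakk>c \<in> carrier S; is_join S {a, b} j\<rbrakk> \<Longrightarrow> is_join S {c \<otimes> a, c \<otimes> b} (c \<otimes> j)"
    and zero_projection: "\<exists>z. is_zero S z \<and> z\<^sup>\<star> = z"
begin

lemma is_join_empty: "is_zero S z \<Longrightarrow> is_join S {} z"
proof (rule is_joinI)
  assume z: "is_zero S z"
  obtain z' where z': "is_zero S z'" "z'\<^sup>\<star> = z'" using zero_projection by blast
  then have "z' = z" using z unfolding is_zero_def by metis
  then show "z \<preceq> u" if "u \<in> carrier S" for u
    using that z z' by (simp add: is_zero_def nat_le_iff)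
  show "z \<in> carrier S" using z by (simp add: is_zero_def)
qed auto

lemma bounded_finite_join:
  assumes "finite F" "F \<subseteq> carrier S" "u \<in> carrier S" "\<And>f. f \<in> F \<Longrightarrow> f \<preceq> u"
  shows "\<exists>j. is_join S F j"
  using assms
proof (induction F rule: finite_induct)
  case empty
  then show ?case using is_join_empty zero_projection by blast
next
  case (insert a F)
  then obtain k where k: "is_join S F k" by blast
  have "k \<preceq> u" using insert.prems by (intro is_join_least[OF k]) auto
  then obtain j where "is_join S {a, k} j"
    using bounded_join[of a k u] insert.prems is_join_carrier[OF k] by auto
  then show ?case using is_join_insert[OF k] by blast
qed

text \<open>Joins of subsets are the intermediate joins needed for inductions that add one element at a
  time.\<close>

lemma subset_join_exists:
  assumes "is_join S F j" "finite F" "G \<subseteq> F"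
  shows "\<exists>k. is_join S G k"
  using assms is_join_upper[OF assms(1)] is_join_subset[OF assms(1)] is_join_carrier[OF assms(1)]
  by (intro bounded_finite_join[of G j]) (auto intro: finite_subset)

lemma finite_join_mult_right:
  assumes "finite F" "is_join S F j" "c \<in> carrier S"
  shows "is_join S ((\<lambda>f. f \<otimes> c) ` F) (j \<otimes> c)"
  using assms(1,2)
proof (induction F arbitrary: j rule: finite_induct)
  case empty
  obtain z where z: "is_zero S z" using zero_projection by blast
  then have "j = z" using empty is_join_empty is_join_unique by blast
  then show ?case using z assms(3) is_join_empty by (simp add: is_zero_def)
next
  case (insert a F)
  obtain k where k: "is_join S F k" using subset_join_exists[OF insert.prems, of F] insert.hyps by auto
  show ?case
    using is_join_insert[OF insert.IH[OF k]]
      join_mult_right[OF assms(3) is_join_insertD[OF k insert.prems]] by simp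
qed

lemma finite_join_mult_left:
  assumes "finite F" "is_join S F j" "c \<in> carrier S"
  shows "is_join S ((\<lambda>f. c \<otimes> f) ` F) (c \<otimes> j)"
  using assms(1,2)
proof (induction F arbitrary: j rule: finite_induct)
  case empty
  obtain z where z: "is_zero S z" using zero_projection by blast
  then have "j = z" using empty is_join_empty is_join_unique by blast
  then show ?case using z assms(3) is_join_empty by (simp add: is_zero_def)
next
  case (insert a F)
  obtain k where k: "is_join S F k" using subset_join_exists[OF insert.prems, of F] insert.hyps by auto
  show ?case
    using is_join_insert[OF insert.IH[OF k]]
      join_mult_left[OF assms(3) is_join_insertD[OF k insert.prems]] by simp
qed

lemma finite_join_star:
  assumes "finite F" "is_join S F j"
  shows "is_join S (star S ` F) (j\<^sup>\<star>)"
proof -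
  have "\<exists>e. is_join S (star S ` F) e"
    using assms(1) is_join_subset[OF assms(2)] is_join_carrier[OF assms(2)] is_join_upper[OF assms(2)]
    by (intro bounded_finite_join[of _ "j\<^sup>\<star>"]) (auto simp: star_closed intro!: star_mono)
  then show ?thesis using star_of_join[OF assms(2)] by blast
qed

text \<open>Restricting a decomposition of \<open>j\<close> to the domain of \<open>a\<close> decomposes \<open>a\<close> into
  elements that lie below the given ones. Down-closed sets are therefore compatible with taking
  joins.\<close>

lemma finite_join_below:
  assumes "finite F" "is_join S F j" "a \<preceq> j" "a \<in> carrier S"
  shows "is_join S ((\<lambda>f. f \<otimes> a\<^sup>\<star>) ` F) a"
  using finite_join_mult_right[OF assms(1,2), of "a\<^sup>\<star>"] belowD[OF assms(3)] assms(4)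
  by (simp add: star_closed)

text \<open>Both \<open>j \<otimes> c\<^sup>\<star>\<close> and \<open>c \<otimes> j\<^sup>\<star>\<close> are the join of the elements
  \<open>f \<otimes> c\<^sup>\<star> = c \<otimes> f\<^sup>\<star>\<close>.\<close>

lemma left_compatible_join:
  assumes "finite F" "is_join S F j" "c \<in> carrier S" "\<And>f. f \<in> F \<Longrightarrow> left_compatible S f c"
  shows "left_compatible S j c"
proof -
  have "is_join S ((\<lambda>f. f \<otimes> c\<^sup>\<star>) ` F) (j \<otimes> c\<^sup>\<star>)"
    using assms by (intro finite_join_mult_right) (auto simp: star_closed)
  moreover have "is_join S ((\<lambda>f. c \<otimes> f) ` star S ` F) (c \<otimes> j\<^sup>\<star>)"
    using assms by (intro finite_join_mult_left finite_join_star) auto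
  moreover have "(\<lambda>f. f \<otimes> c\<^sup>\<star>) ` F = (\<lambda>f. c \<otimes> f) ` star S ` F"
    unfolding image_image using assms(4) by (intro image_cong) (auto simp: left_compatible_def)
  ultimately show ?thesis unfolding left_compatible_def using is_join_unique by simp
qed

end

section \<open>Inverse monoids\<close>

lemma to_rr_simps [simp]:
  "carrier (to_rr B) = carrier B" "mult (to_rr B) = mult B" "one (to_rr B) = one B"
  by (simp_all add: to_rr_def)

lemma star_to_rr: "star (to_rr B) a = ginv B a \<otimes>\<^bsub>B\<^esub> a"
  by (simp add: to_rr_def)

context inverse_monoid
begin

abbreviation inverse_of (\<open>(_\<^sup>-)\<close> [1000] 1000) where "a\<^sup>- \<equiv> ginv B a"

lemma
  assumes "a \<in> carrier B"
  shows ginv_closed [simp]: "a\<^sup>- \<in> carrier B"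
    and mult_ginv_mult: "a \<otimes> a\<^sup>- \<otimes> a = a"
    and ginv_mult_ginv: "a\<^sup>- \<otimes> a \<otimes> a\<^sup>- = a\<^sup>-"
  using theI'[OF unique_inverse[OF assms]] by (simp_all add: ginv_def)

lemma ginv_eqI:
  "\<lbrakk>a \<in> carrier B; b \<in> carrier B; a \<otimes> b \<otimes> a = a; b \<otimes> a \<otimes> b = b\<rbrakk> \<Longrightarrow> a\<^sup>- = b"
  unfolding ginv_def by (rule the1_equality[OF unique_inverse]) auto

lemma ginv_ginv [simp]: "a \<in> carrier B \<Longrightarrow> a\<^sup>-\<^sup>- = a"
  by (rule ginv_eqI) (auto simp: mult_ginv_mult ginv_mult_ginv)

lemma ginv_idempotent: "e \<in> idempotents B \<Longrightarrow> e\<^sup>- = e"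
  by (rule ginv_eqI) (auto simp: idempotents_def)

text \<open>With \<open>x\<close> the inverse of \<open>e \<otimes> f\<close>, the product \<open>f \<otimes> x \<otimes> e\<close> is an inverse
  of \<open>e \<otimes> f\<close> too, hence equal to \<open>x\<close>, which makes \<open>x\<close> idempotent. An idempotent
  is its own inverse, so \<open>e \<otimes> f = x\<close>.\<close>

lemma idempotent_mult:
  assumes e: "e \<in> idempotents B" and f: "f \<in> idempotents B"
  shows "e \<otimes> f \<in> idempotents B"
proof -
  have c [simp]: "e \<in> carrier B" "f \<in> carrier B" and i: "e \<otimes> e = e" "f \<otimes> f = f"
    using e f by (auto simp: idempotents_def)
  have ia: "e \<otimes> (e \<otimes> x) = e \<otimes> x" "f \<otimes> (f \<otimes> x) = f \<otimes> x" if "x \<in> carrier B" for x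
    using that i by (simp_all flip: m_assoc)
  define x where "x = (e \<otimes> f)\<^sup>-"
  have xc [simp]: "x \<in> carrier B" by (simp add: x_def)
  have x1: "e \<otimes> (f \<otimes> (x \<otimes> (e \<otimes> f))) = e \<otimes> f"
    using mult_ginv_mult[of "e \<otimes> f"] by (simp add: x_def m_assoc)
  have x2: "x \<otimes> (e \<otimes> (f \<otimes> x)) = x"
    using ginv_mult_ginv[of "e \<otimes> f"] by (simp add: x_def m_assoc)
  then have x3: "x \<otimes> (e \<otimes> (f \<otimes> (x \<otimes> y))) = x \<otimes> y" if "y \<in> carrier B" for y
    using that by (metis c m_assoc m_closed xc)
  have "(e \<otimes> f)\<^sup>- = f \<otimes> (x \<otimes> e)"
    by (rule ginv_eqI) (simp_all add: m_assoc ia x1 x3)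
  from this[folded x_def, symmetric] have xe: "f \<otimes> (x \<otimes> e) = x" .
  have "f \<otimes> (x \<otimes> e) \<otimes> (f \<otimes> (x \<otimes> e)) = f \<otimes> (x \<otimes> e)" by (simp add: m_assoc x3)
  then have "x \<in> idempotents B" by (simp add: xe idempotents_def)
  moreover have "e \<otimes> f = x\<^sup>-" by (simp add: x_def)
  ultimately show ?thesis using ginv_idempotent by simp
qed

text \<open>Both \<open>f \<otimes> e\<close> and the idempotent \<open>e \<otimes> f\<close> itself are inverses of
  \<open>e \<otimes> f\<close>.\<close>

lemma idempotents_commute:
  assumes e: "e \<in> idempotents B" and f: "f \<in> idempotents B"
  shows "e \<otimes> f = f \<otimes> e"
proof -
  have c [simp]: "e \<in> carrier B" "f \<in> carrier B" and i: "e \<otimes> e = e" "f \<otimes> f = f"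
    using e f by (auto simp: idempotents_def)
  have ia: "e \<otimes> (e \<otimes> x) = e \<otimes> x" "f \<otimes> (f \<otimes> x) = f \<otimes> x" if "x \<in> carrier B" for x
    using that i by (simp_all flip: m_assoc)
  have ef: "e \<otimes> (f \<otimes> (e \<otimes> f)) = e \<otimes> f" and fe: "f \<otimes> (e \<otimes> (f \<otimes> e)) = f \<otimes> e"
    using idempotent_mult[OF e f] idempotent_mult[OF f e] by (simp_all add: idempotents_def m_assoc)
  have "(e \<otimes> f)\<^sup>- = f \<otimes> e"
    by (rule ginv_eqI) (simp_all add: m_assoc ia ef fe)
  then show ?thesis using ginv_idempotent[OF idempotent_mult[OF e f]] by simp
qed

lemma idempotent_ginv_mult: "a \<in> carrier B \<Longrightarrow> a\<^sup>- \<otimes> a \<in> idempotents B"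
  and idempotent_mult_ginv: "a \<in> carrier B \<Longrightarrow> a \<otimes> a\<^sup>- \<in> idempotents B"
  by (simp_all add: idempotents_def mult_ginv_mult ginv_mult_ginv flip: m_assoc)

lemma ginv_mult:
  assumes [simp]: "a \<in> carrier B" "b \<in> carrier B"
  shows "(a \<otimes> b)\<^sup>- = b\<^sup>- \<otimes> a\<^sup>-"
proof (rule ginv_eqI)
  have comm: "(a\<^sup>- \<otimes> a) \<otimes> (b \<otimes> b\<^sup>-) = (b \<otimes> b\<^sup>-) \<otimes> (a\<^sup>- \<otimes> a)"
    by (intro idempotents_commute idempotent_ginv_mult idempotent_mult_ginv) auto
  have "a \<otimes> b \<otimes> (b\<^sup>- \<otimes> a\<^sup>-) \<otimes> (a \<otimes> b) = a \<otimes> ((b \<otimes> b\<^sup>-) \<otimes> (a\<^sup>- \<otimes> a)) \<otimes> b"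
    by (simp add: m_assoc)
  also have "\<dots> = a \<otimes> ((a\<^sup>- \<otimes> a) \<otimes> (b \<otimes> b\<^sup>-)) \<otimes> b" by (simp only: comm)
  also have "\<dots> = (a \<otimes> a\<^sup>- \<otimes> a) \<otimes> (b \<otimes> b\<^sup>- \<otimes> b)" by (simp add: m_assoc)
  finally show "a \<otimes> b \<otimes> (b\<^sup>- \<otimes> a\<^sup>-) \<otimes> (a \<otimes> b) = a \<otimes> b" by (simp add: mult_ginv_mult)
  have "b\<^sup>- \<otimes> a\<^sup>- \<otimes> (a \<otimes> b) \<otimes> (b\<^sup>- \<otimes> a\<^sup>-) = b\<^sup>- \<otimes> ((a\<^sup>- \<otimes> a) \<otimes> (b \<otimes> b\<^sup>-)) \<otimes> a\<^sup>-"
    by (simp add: m_assoc)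
  also have "\<dots> = b\<^sup>- \<otimes> ((b \<otimes> b\<^sup>-) \<otimes> (a\<^sup>- \<otimes> a)) \<otimes> a\<^sup>-" by (simp only: comm)
  also have "\<dots> = (b\<^sup>- \<otimes> b \<otimes> b\<^sup>-) \<otimes> (a\<^sup>- \<otimes> a \<otimes> a\<^sup>-)" by (simp add: m_assoc)
  finally show "b\<^sup>- \<otimes> a\<^sup>- \<otimes> (a \<otimes> b) \<otimes> (b\<^sup>- \<otimes> a\<^sup>-) = b\<^sup>- \<otimes> a\<^sup>-" by (simp add: ginv_mult_ginv)
qed auto

lemma star_in_idempotents: "a \<in> carrier B \<Longrightarrow> star (to_rr B) a \<in> idempotents B"
  by (simp add: star_to_rr idempotent_ginv_mult)

lemma star_idempotent: "e \<in> idempotents B \<Longrightarrow> star (to_rr B) e = e"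
  by (simp add: star_to_rr ginv_idempotent) (simp add: idempotents_def)

lemma idempotents_closed: "e \<in> idempotents B \<Longrightarrow> e \<in> carrier B"
  by (simp add: idempotents_def)

lemma right_restriction_monoid_to_rr: "right_restriction_monoid (to_rr B)"
proof -
  let ?s = "star (to_rr B)"
  have "monoid (to_rr B)" by unfold_locales (auto simp: m_assoc)
  moreover have "right_restriction_monoid_axioms (to_rr B)"
  proof (unfold_locales, unfold to_rr_simps)
    fix s t assume s [simp]: "s \<in> carrier B" and t [simp]: "t \<in> carrier B"
    note si = star_in_idempotents[OF s] and ti = star_in_idempotents[OF t]
    note cl [simp] = idempotents_closed[OF si] idempotents_closed[OF ti]
    show "?s s \<in> carrier B" by simp
    show "?s (?s s) = ?s s" using si by (rule star_idempotent)
    show "?s (?s s \<otimes> ?s t) = ?s s \<otimes> ?s t" using si ti by (intro star_idempotent idempotent_mult)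
    show "?s s \<otimes> ?s t = ?s t \<otimes> ?s s" using si ti by (rule idempotents_commute)
    show "s \<otimes> ?s s = s" by (simp add: star_to_rr mult_ginv_mult flip: m_assoc)
    have "?s (?s s \<otimes> t) = t\<^sup>- \<otimes> (?s s \<otimes> ?s s) \<otimes> t"
      using ginv_idempotent[OF si] by (simp add: star_to_rr[of B "?s s \<otimes> t"] ginv_mult m_assoc)
    also have "?s s \<otimes> ?s s = ?s s" using si by (simp add: idempotents_def)
    also have "t\<^sup>- \<otimes> ?s s \<otimes> t = ?s (s \<otimes> t)" by (simp add: star_to_rr ginv_mult m_assoc)
    finally show "?s (s \<otimes> t) = ?s (?s s \<otimes> t)" by simp
    have "s \<otimes> ?s (t \<otimes> s) = (s \<otimes> s\<^sup>-) \<otimes> ?s t \<otimes> s"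
      by (simp add: star_to_rr ginv_mult m_assoc)
    also have "(s \<otimes> s\<^sup>-) \<otimes> ?s t = ?s t \<otimes> (s \<otimes> s\<^sup>-)"
      using ti by (intro idempotents_commute idempotent_mult_ginv) auto
    also have "?s t \<otimes> (s \<otimes> s\<^sup>-) \<otimes> s = ?s t \<otimes> (s \<otimes> s\<^sup>- \<otimes> s)" by (simp add: m_assoc)
    finally show "?s t \<otimes> s = s \<otimes> ?s (t \<otimes> s)" by (simp add: mult_ginv_mult)
  qed
  ultimately show ?thesis by (simp add: right_restriction_monoid_def)
qed

end

sublocale inverse_monoid \<subseteq> rr: right_restriction_monoid "to_rr B"
  rewrites "carrier (to_rr B) = carrier B" and "mult (to_rr B) = mult B" and "one (to_rr B) = one B"
  by (simp_all add: right_restriction_monoid_to_rr)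

context inverse_monoid
begin

text \<open>This turns idempotency into an upper bound, so that a join of idempotents is seen to be
  idempotent.\<close>

lemma idempotent_iff_below_one: "e \<in> carrier B \<Longrightarrow> e \<in> idempotents B \<longleftrightarrow> e \<preceq>\<^bsub>to_rr B\<^esub> \<one>"
  using rr.below_one_iff[of e] star_idempotent[of e] star_in_idempotents[of e] by fastforce

text \<open>With \<open>a = u \<otimes> e\<close> and \<open>b = u \<otimes> f\<close> for idempotents \<open>e\<close> and \<open>f\<close>, the two products
  in question are \<open>e \<otimes> (u\<^sup>- \<otimes> u) \<otimes> f\<close> and the conjugate \<open>u \<otimes> (e \<otimes> f) \<otimes> u\<^sup>-\<close>.\<close>

lemma bounded_imp_compatible:
  assumes "a \<preceq>\<^bsub>to_rr B\<^esub> u" "b \<preceq>\<^bsub>to_rr B\<^esub> u" and [simp]: "a \<in> carrier B" "b \<in> carrier B" "u \<in> carrier B"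
  shows "compatible B a b"
proof -
  obtain e f where a: "a = u \<otimes> e" and b: "b = u \<otimes> f"
    and e: "e \<in> idempotents B" "f \<in> idempotents B"
    using that[OF rr.belowD[OF assms(1), symmetric] rr.belowD[OF assms(2), symmetric]]
    by (simp add: star_in_idempotents)
  note [simp] = idempotents_closed[OF e(1)] idempotents_closed[OF e(2)]
  have "a\<^sup>- \<otimes> b = e \<otimes> (u\<^sup>- \<otimes> u) \<otimes> f"
    by (simp add: a b ginv_mult ginv_idempotent e m_assoc)
  then have 1: "a\<^sup>- \<otimes> b \<in> idempotents B"
    by (simp add: idempotent_mult e idempotent_ginv_mult)
  have ef: "e \<otimes> f \<in> idempotents B" using e by (rule idempotent_mult)
  have "a \<otimes> b\<^sup>- = u \<otimes> (e \<otimes> f) \<otimes> u\<^sup>-"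
    by (simp add: a b ginv_mult ginv_idempotent e m_assoc)
  also have "\<dots> = u \<otimes> ((e \<otimes> f) \<otimes> (e \<otimes> f)) \<otimes> u\<^sup>-"
    using ef by (simp add: idempotents_def)
  also have "\<dots> = (u \<otimes> (e \<otimes> f)) \<otimes> (u \<otimes> (e \<otimes> f))\<^sup>-"
    by (subst ginv_mult[of u]) (simp_all add: ginv_idempotent[OF ef] m_assoc)
  finally have "a \<otimes> b\<^sup>- \<in> idempotents B" by (simp add: idempotent_mult_ginv)
  with 1 show ?thesis by (simp add: compatible_def)
qed

text \<open>Left compatibility is one half of compatibility.\<close>

lemma left_compatible_iff:
  assumes [simp]: "x \<in> carrier B" "y \<in> carrier B"
  shows "left_compatible (to_rr B) x y \<longleftrightarrow> x \<otimes> y\<^sup>- \<in> idempotents B"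
proof
  assume "left_compatible (to_rr B) x y"
  then have xy: "x \<otimes> (y\<^sup>- \<otimes> y) = y \<otimes> (x\<^sup>- \<otimes> x)"
    by (simp add: left_compatible_def star_to_rr)
  have "x \<otimes> y\<^sup>- = x \<otimes> (y\<^sup>- \<otimes> y) \<otimes> y\<^sup>-"
    using ginv_mult_ginv[of y] by (simp add: m_assoc)
  also have "\<dots> = (y \<otimes> x\<^sup>-) \<otimes> (y \<otimes> x\<^sup>-)\<^sup>-" unfolding xy by (simp add: m_assoc ginv_mult)
  finally show "x \<otimes> y\<^sup>- \<in> idempotents B" by (simp add: idempotent_mult_ginv)
next
  assume p: "x \<otimes> y\<^sup>- \<in> idempotents B"
  have yx: "y \<otimes> x\<^sup>- = x \<otimes> y\<^sup>-" using ginv_idempotent[OF p] by (simp add: ginv_mult)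
  have "y \<otimes> (x\<^sup>- \<otimes> x) = y \<otimes> ((y\<^sup>- \<otimes> y) \<otimes> (x\<^sup>- \<otimes> x))"
    using mult_ginv_mult[of y] by (simp flip: m_assoc)
  also have "(y\<^sup>- \<otimes> y) \<otimes> (x\<^sup>- \<otimes> x) = (x\<^sup>- \<otimes> x) \<otimes> (y\<^sup>- \<otimes> y)"
    by (intro idempotents_commute idempotent_ginv_mult) auto
  also have "y \<otimes> ((x\<^sup>- \<otimes> x) \<otimes> (y\<^sup>- \<otimes> y)) = (y \<otimes> x\<^sup>-) \<otimes> (x \<otimes> y\<^sup>-) \<otimes> y"
    by (simp add: m_assoc)
  also have "(y \<otimes> x\<^sup>-) \<otimes> (x \<otimes> y\<^sup>-) = x \<otimes> y\<^sup>-" using p by (simp add: yx idempotents_def)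
  finally show "left_compatible (to_rr B) x y"
    by (simp add: left_compatible_def star_to_rr m_assoc)
qed

end

text \<open>The axioms speak of compatible pairs, which by \<open>bounded_imp_compatible\<close> include all pairs with a
  common upper bound.\<close>

sublocale boolean_inverse_monoid \<subseteq> rr: finite_join_rr_monoid "to_rr B"
  rewrites "carrier (to_rr B) = carrier B" and "mult (to_rr B) = mult B" and "one (to_rr B) = one B"
proof -
  have c: "compatible B a b" "a \<in> carrier B" "b \<in> carrier B" if "is_join (to_rr B) {a, b} j" for a b j
    using that rr.is_join_carrier[OF that] rr.is_join_subset[OF that]
    by (auto intro: bounded_imp_compatible[of a j b] rr.is_join_upper[OF that])
  show "finite_join_rr_monoid (to_rr B)"
  proof unfold_locales
    show "\<exists>j. is_join (to_rr B) {a, b} j"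
      if "a \<in> carrier (to_rr B)" "b \<in> carrier (to_rr B)" "u \<in> carrier (to_rr B)" "a \<preceq>\<^bsub>to_rr B\<^esub> u" "b \<preceq>\<^bsub>to_rr B\<^esub> u"
      for a b u
      using that binary_join_exists bounded_imp_compatible by simp
    show "is_join (to_rr B) {a \<otimes>\<^bsub>to_rr B\<^esub> x, b \<otimes>\<^bsub>to_rr B\<^esub> x} (j \<otimes>\<^bsub>to_rr B\<^esub> x)"
      if "x \<in> carrier (to_rr B)" "is_join (to_rr B) {a, b} j" for a b j x
      using that c[OF that(2)] binary_join_mult_right by simp
    show "is_join (to_rr B) {x \<otimes>\<^bsub>to_rr B\<^esub> a, x \<otimes>\<^bsub>to_rr B\<^esub> b} (x \<otimes>\<^bsub>to_rr B\<^esub> j)"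
      if "x \<in> carrier (to_rr B)" "is_join (to_rr B) {a, b} j" for a b j x
      using that c[OF that(2)] binary_join_mult_left by simp
    obtain z where "is_zero B z" using zero_exists by blast
    then show "\<exists>z. is_zero (to_rr B) z \<and> star (to_rr B) z = z"
      by (auto simp: is_zero_def star_to_rr)
  qed
qed simp_all

section \<open>Nucleus-closed ideals and their finite elements\<close>

definition ideal_below :: "('b, 'm) monoid_scheme \<Rightarrow> 'b \<Rightarrow> 'b set" (\<open>\<down>\<index>_\<close> [90] 90)
  where "\<down>\<^bsub>B\<^esub>b = {x \<in> carrier B. x \<preceq>\<^bsub>to_rr B\<^esub> b}"

context boolean_inverse_monoid
begin

lemma join_imp_compatible:
  assumes "is_join (to_rr B) F j" "x \<in> F" "y \<in> F"
  shows "compatible B x y"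
  using assms rr.is_join_subset[OF assms(1)]
  by (intro bounded_imp_compatible[of x j y])
    (auto intro: rr.is_join_upper[OF assms(1)] rr.is_join_carrier[OF assms(1)])

text \<open>For the induction step, \<open>a\<close> has to be compatible with the join \<open>k\<close> of the other
  elements. As \<open>a\<^sup>- \<otimes> k\<close> and \<open>k \<otimes> a\<^sup>-\<close> are joins of idempotents, they lie below
  \<open>\<one>\<close>.\<close>

lemma compatible_finite_join:
  assumes "finite F" "F \<subseteq> carrier B" "\<And>x y. x \<in> F \<Longrightarrow> y \<in> F \<Longrightarrow> compatible B x y"
  shows "\<exists>j. is_join (to_rr B) F j"
  using assms
proof (induction F rule: finite_induct)
  case empty
  then show ?case using rr.is_join_empty rr.zero_projection by blast
next
  case (insert a F)
  then obtain k where k: "is_join (to_rr B) F k" by blast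
  note kc [simp] = rr.is_join_carrier[OF k]
  have a [simp]: "a \<in> carrier B" and F: "f \<in> carrier B" if "f \<in> F" for f
    using insert.prems(1) that by auto
  have le: "a\<^sup>- \<otimes> f \<preceq>\<^bsub>to_rr B\<^esub> \<one>" "f \<otimes> a\<^sup>- \<preceq>\<^bsub>to_rr B\<^esub> \<one>" if "f \<in> F" for f
    using insert.prems(2)[of a f] insert.prems(2)[of f a] that F[OF that] a
    by (auto simp: compatible_def idempotent_iff_below_one[symmetric])
  have a [simp]: "a \<in> carrier B" using insert.prems(1) by auto
  have "a\<^sup>- \<otimes> k \<preceq>\<^bsub>to_rr B\<^esub> \<one>"
    using le by (intro rr.is_join_least[OF rr.finite_join_mult_left[OF insert.hyps(1) k]]) auto
  moreover have "k \<otimes> a\<^sup>- \<preceq>\<^bsub>to_rr B\<^esub> \<one>"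
    using le by (intro rr.is_join_least[OF rr.finite_join_mult_right[OF insert.hyps(1) k]]) auto
  then have ka: "k \<otimes> a\<^sup>- \<in> idempotents B" by (simp add: idempotent_iff_below_one)
  then have "a \<otimes> k\<^sup>- \<in> idempotents B" using ginv_idempotent[OF ka] by (simp add: ginv_mult)
  ultimately have "compatible B a k" by (simp add: compatible_def idempotent_iff_below_one)
  then show ?case using binary_join_exists[of a k] rr.is_join_insert[OF k] by auto
qed

text \<open>A set that has a join is bounded, hence compatible.\<close>

lemma nucleus_eq: "nucleus B X = {j. \<exists>F\<subseteq>X. finite F \<and> is_join (to_rr B) F j}"
  unfolding nucleus_def using join_imp_compatible by blast

lemma nucleusI: "\<lbrakk>finite F; F \<subseteq> X; is_join (to_rr B) F j\<rbrakk> \<Longrightarrow> j \<in> nucleus B X"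
  unfolding nucleus_eq by blast

lemma nucleusE:
  assumes "j \<in> nucleus B X"
  obtains F where "finite F" "F \<subseteq> X" "is_join (to_rr B) F j"
  using assms unfolding nucleus_eq by blast

lemma nucleus_closed: "nucleus B X \<subseteq> carrier B"
  using rr.is_join_carrier by (auto elim!: nucleusE)

lemma nucleus_mono: "X \<subseteq> Y \<Longrightarrow> nucleus B X \<subseteq> nucleus B Y"
  unfolding nucleus_eq by blast

lemma nucleus_increasing: "X \<subseteq> carrier B \<Longrightarrow> X \<subseteq> nucleus B X"
  using rr.is_join_single by (auto intro!: nucleusI[of "{_}"])

lemma nucleus_idem:
  assumes "X \<subseteq> carrier B"
  shows "nucleus B (nucleus B X) = nucleus B X"
proof
  show "nucleus B (nucleus B X) \<subseteq> nucleus B X"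
  proof
    fix j assume "j \<in> nucleus B (nucleus B X)"
    then obtain F where F: "finite F" "F \<subseteq> nucleus B X" "is_join (to_rr B) F j" by (rule nucleusE)
    then have "\<forall>f\<in>F. \<exists>G\<subseteq>X. finite G \<and> is_join (to_rr B) G f" unfolding nucleus_eq by blast
    then obtain G where G: "\<And>f. f \<in> F \<Longrightarrow> G f \<subseteq> X \<and> finite (G f) \<and> is_join (to_rr B) (G f) f"
      by metis
    have "is_join (to_rr B) (\<Union>f\<in>F. G f) j"
      using F(3) G by (intro rr.is_join_UN[of "\<lambda>f. f"]) auto
    then show "j \<in> nucleus B X" using F(1) G by (intro nucleusI[of "\<Union>f\<in>F. G f"]) auto
  qed
qed (rule nucleus_increasing[OF nucleus_closed])

text \<open>Left compatibility passes to joins in one argument and then, by symmetry, in the other;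
  elements below a join decompose into elements below the members that are joined.\<close>

lemma acceptable_nucleus:
  assumes X: "acceptable B X"
  shows "acceptable B (nucleus B X)"
  unfolding acceptable_def
proof (intro conjI ballI impI)
  have Xc: "X \<subseteq> carrier B" using X by (simp add: acceptable_def)
  show "nucleus B X \<subseteq> carrier B" by (rule nucleus_closed)
  have lc: "left_compatible (to_rr B) x y" if x: "x \<in> nucleus B X" and y: "y \<in> X" for x y
  proof -
    obtain F where F: "finite F" "F \<subseteq> X" "is_join (to_rr B) F x" using x by (rule nucleusE)
    then show ?thesis using X y Xc by (intro rr.left_compatible_join[OF F(1,3)]) (auto simp: acceptable_def)
  qed
  show "left_compatible (to_rr B) x y" if x: "x \<in> nucleus B X" and y: "y \<in> nucleus B X" for x y
  proof -
    obtain F where F: "finite F" "F \<subseteq> X" "is_join (to_rr B) F x" using x by (rule nucleusE)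
    then show ?thesis using lc[OF y] y nucleus_closed[of X]
      by (intro rr.left_compatible_join[OF F(1,3)]) (auto intro: rr.left_compatible_sym)
  qed
  show "y \<in> nucleus B X" if x: "x \<in> nucleus B X" and y: "y \<in> carrier B" "y \<preceq>\<^bsub>to_rr B\<^esub> x" for x y
  proof -
    obtain F where F: "finite F" "F \<subseteq> X" "is_join (to_rr B) F x" using x by (rule nucleusE)
    let ?G = "(\<lambda>f. f \<otimes> star (to_rr B) y) ` F"
    have "?G \<subseteq> X"
    proof clarify
      fix f assume f: "f \<in> F"
      then have "f \<otimes> star (to_rr B) y \<preceq>\<^bsub>to_rr B\<^esub> f" "f \<otimes> star (to_rr B) y \<in> carrier B"
        using F(2) Xc y by (auto intro!: rr.mult_star_below rr.star_closed m_closed)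
      then show "f \<otimes> star (to_rr B) y \<in> X" using X f F(2) by (auto simp: acceptable_def)
    qed
    then show ?thesis using rr.finite_join_below[OF F(1,3) y(2,1)] F(1) by (intro nucleusI) auto
  qed
qed

lemma carrier_R_nu_iff: "X \<in> carrier (R_nu_monoid B) \<longleftrightarrow> acceptable B X \<and> nucleus B X = X"
  by (simp add: R_nu_monoid_def R_monoid_def)

lemma nucleus_in_R_nu: "acceptable B X \<Longrightarrow> nucleus B X \<in> carrier (R_nu_monoid B)"
  using nucleus_idem[of X] by (simp add: carrier_R_nu_iff acceptable_nucleus) (simp add: acceptable_def)

lemma
  assumes "X \<in> carrier (R_nu_monoid B)"
  shows R_nu_subset: "X \<subseteq> carrier B"
    and R_nu_left_compatible: "\<lbrakk>x \<in> X; y \<in> X\<rbrakk> \<Longrightarrow> left_compatible (to_rr B) x y"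
    and R_nu_down_closed: "\<lbrakk>x \<in> X; y \<preceq>\<^bsub>to_rr B\<^esub> x; y \<in> carrier B\<rbrakk> \<Longrightarrow> y \<in> X"
    and R_nu_join_closed: "\<lbrakk>finite F; F \<subseteq> X; is_join (to_rr B) F j\<rbrakk> \<Longrightarrow> j \<in> X"
  using assms nucleusI[of F X j] by (auto simp: carrier_R_nu_iff acceptable_def)

lemma R_nuI:
  assumes "X \<subseteq> carrier B" "\<And>x y. \<lbrakk>x \<in> X; y \<in> X\<rbrakk> \<Longrightarrow> left_compatible (to_rr B) x y"
    and "\<And>x y. \<lbrakk>x \<in> X; y \<in> carrier B; y \<preceq>\<^bsub>to_rr B\<^esub> x\<rbrakk> \<Longrightarrow> y \<in> X"
    and "\<And>F j. \<lbrakk>finite F; F \<subseteq> X; is_join (to_rr B) F j\<rbrakk> \<Longrightarrow> j \<in> X"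
  shows "X \<in> carrier (R_nu_monoid B)"
  using assms nucleus_increasing[of X]
  by (auto simp: carrier_R_nu_iff acceptable_def elim!: nucleusE)

lemma nucleus_subset_R_nu:
  "\<lbrakk>Y \<in> carrier (R_nu_monoid B); X \<subseteq> Y\<rbrakk> \<Longrightarrow> nucleus B X \<subseteq> Y"
  using nucleus_mono[of X Y] by (simp add: carrier_R_nu_iff)

lemma mult_R_nu: "X \<otimes>\<^bsub>R_nu_monoid B\<^esub> Y = nucleus B (X <#>\<^bsub>B\<^esub> Y)"
  and star_R_nu: "star (R_nu_monoid B) X = nucleus B (star (to_rr B) ` X)"
  by (simp_all add: R_nu_monoid_def R_monoid_def)

lemma R_nu_star_idempotents:
  assumes "X \<subseteq> carrier B" "e \<in> star (R_nu_monoid B) X"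
  shows "e \<in> idempotents B"
proof -
  obtain F where F: "finite F" "F \<subseteq> star (to_rr B) ` X" "is_join (to_rr B) F e"
    using assms(2) unfolding star_R_nu by (rule nucleusE)
  have "f \<preceq>\<^bsub>to_rr B\<^esub> \<one>" if "f \<in> F" for f
  proof -
    have "f \<in> idempotents B" using that F(2) assms(1) by (auto intro: star_in_idempotents)
    then show ?thesis by (simp add: idempotents_closed flip: idempotent_iff_below_one)
  qed
  then have "e \<preceq>\<^bsub>to_rr B\<^esub> \<one>" by (intro rr.is_join_least[OF F(3)]) auto
  then show ?thesis using rr.is_join_carrier[OF F(3)] idempotent_iff_below_one by simp
qed

text \<open>Multiplying \<open>Y\<close> by idempotents only produces restrictions of members of \<open>Y\<close>,
  which gives one direction. Conversely, let \<open>X \<subseteq> Y\<close>. By left compatibility inside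
  \<open>Y\<close>, restricting \<open>y \<in> Y\<close> to the domain of \<open>x \<in> X\<close> is the same as restricting
  \<open>x\<close> to the domain of \<open>y\<close>, so \<open>Y \<cdot> X\<^sup>\<circ>\<close> does not leave \<open>X\<close>.\<close>

lemma R_nu_le_iff:
  assumes X: "X \<in> carrier (R_nu_monoid B)" and Y: "Y \<in> carrier (R_nu_monoid B)"
  shows "X \<preceq>\<^bsub>R_nu_monoid B\<^esub> Y \<longleftrightarrow> X \<subseteq> Y"
proof
  note Xc = R_nu_subset[OF X] and Yc = R_nu_subset[OF Y]
  let ?E = "star (R_nu_monoid B) X"
  {
    assume "X \<preceq>\<^bsub>R_nu_monoid B\<^esub> Y"
    then have "X = nucleus B (Y <#>\<^bsub>B\<^esub> ?E)" by (simp add: nat_le_iff mult_R_nu)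
    moreover have "Y <#>\<^bsub>B\<^esub> ?E \<subseteq> Y"
    proof -
      have "y \<otimes> e \<in> Y" if "y \<in> Y" "e \<in> ?E" for y e
      proof -
        have e: "e \<in> idempotents B" using R_nu_star_idempotents Xc that by blast
        have "y \<otimes> e \<preceq>\<^bsub>to_rr B\<^esub> y"
          using rr.mult_star_below[of y e] that Yc e idempotents_closed by (auto simp: star_idempotent)
        then show ?thesis using that(1) Yc e by (auto intro: R_nu_down_closed[OF Y] idempotents_closed)
      qed
      then show ?thesis by (auto simp: set_mult_def)
    qed
    ultimately show "X \<subseteq> Y" using nucleus_subset_R_nu[OF Y] by blast
  }
  assume XY: "X \<subseteq> Y"
  have "X = nucleus B (Y <#>\<^bsub>B\<^esub> ?E)"
  proof
    have "star (to_rr B) ` X \<subseteq> ?E"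
      unfolding star_R_nu using Xc by (intro nucleus_increasing) (auto intro: rr.star_closed)
    then have mem: "x \<otimes> star (to_rr B) x \<in> Y <#>\<^bsub>B\<^esub> ?E" if "x \<in> X" for x
      using that XY by (auto simp: set_mult_def)
    have "X \<subseteq> Y <#>\<^bsub>B\<^esub> ?E"
    proof
      fix x assume "x \<in> X"
      then show "x \<in> Y <#>\<^bsub>B\<^esub> ?E" using mem[of x] rr.RR4[of x] Xc by auto
    qed
    moreover have "Y <#>\<^bsub>B\<^esub> ?E \<subseteq> carrier B"
      using Yc nucleus_closed[of "star (to_rr B) ` X"] by (auto simp: set_mult_def star_R_nu)
    ultimately show "X \<subseteq> nucleus B (Y <#>\<^bsub>B\<^esub> ?E)" using nucleus_increasing by blast
    have "y \<otimes> e \<in> X" if y: "y \<in> Y" and "e \<in> ?E" for y e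
    proof -
      obtain F where F: "finite F" "F \<subseteq> star (to_rr B) ` X" "is_join (to_rr B) F e"
        using \<open>e \<in> ?E\<close> unfolding star_R_nu by (rule nucleusE)
      have "y \<otimes> star (to_rr B) x \<in> X" if x: "x \<in> X" for x
      proof -
        have "y \<otimes> star (to_rr B) x = x \<otimes> star (to_rr B) y"
          using R_nu_left_compatible[OF Y y, of x] x XY by (auto simp: left_compatible_def)
        then show ?thesis
          using x y Xc Yc by (auto intro!: R_nu_down_closed[OF X x] rr.mult_star_below rr.star_closed)
      qed
      then have "(\<lambda>f. y \<otimes> f) ` F \<subseteq> X" using F(2) by blast
      then show ?thesis
        using rr.finite_join_mult_left[OF F(1,3)] y Yc F(1) by (intro R_nu_join_closed[OF X]) auto
    qed
    then show "nucleus B (Y <#>\<^bsub>B\<^esub> ?E) \<subseteq> X"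
      by (intro nucleus_subset_R_nu[OF X]) (auto simp: set_mult_def)
  qed
  then show "X \<preceq>\<^bsub>R_nu_monoid B\<^esub> Y" by (simp add: nat_le_iff mult_R_nu)
qed

lemma R_nu_join_iff:
  "is_join (R_nu_monoid B) A J \<longleftrightarrow>
    A \<subseteq> carrier (R_nu_monoid B) \<and> J \<in> carrier (R_nu_monoid B) \<and> \<Union>A \<subseteq> J \<and>
    (\<forall>U\<in>carrier (R_nu_monoid B). \<Union>A \<subseteq> U \<longrightarrow> J \<subseteq> U)"
proof (cases "A \<subseteq> carrier (R_nu_monoid B) \<and> J \<in> carrier (R_nu_monoid B)")
  case True
  have ub: "(\<forall>X\<in>A. X \<preceq>\<^bsub>R_nu_monoid B\<^esub> U) \<longleftrightarrow> \<Union>A \<subseteq> U"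
    if "U \<in> carrier (R_nu_monoid B)" for U
  proof -
    have "(\<forall>X\<in>A. X \<preceq>\<^bsub>R_nu_monoid B\<^esub> U) \<longleftrightarrow> (\<forall>X\<in>A. X \<subseteq> U)"
      using True that by (intro ball_cong refl R_nu_le_iff) auto
    then show ?thesis by (simp add: Sup_le_iff)
  qed
  show ?thesis using True by (simp add: is_join_iff ub R_nu_le_iff)
qed (auto simp: is_join_iff)

text \<open>An upper bound makes the union of \<open>A\<close> left-compatible. Without it the nucleus of the
  union need not belong to the monoid.\<close>

lemma R_nu_bounded_join:
  assumes A: "A \<subseteq> carrier (R_nu_monoid B)" and U: "U \<in> carrier (R_nu_monoid B)" "\<Union>A \<subseteq> U"
  shows "is_join (R_nu_monoid B) A (nucleus B (\<Union>A))"
proof -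
  have c: "\<Union>A \<subseteq> carrier B" using R_nu_subset[OF U(1)] U(2) by blast
  have "acceptable B (\<Union>A)"
    unfolding acceptable_def
    using c R_nu_left_compatible[OF U(1)] U(2) A R_nu_down_closed by blast
  then show ?thesis
    unfolding R_nu_join_iff
    using A nucleus_in_R_nu nucleus_increasing[OF c] nucleus_subset_R_nu by blast
qed

lemma ideal_below_self: "b \<in> carrier B \<Longrightarrow> b \<in> \<down>b"
  by (simp add: ideal_below_def rr.below_refl)

lemma ideal_below_in_R_nu: "b \<in> carrier B \<Longrightarrow> \<down>b \<in> carrier (R_nu_monoid B)"
  unfolding ideal_below_def
  by (rule R_nuI)
    (auto intro: rr.bounded_imp_left_compatible rr.below_trans rr.is_join_carrier rr.is_join_least)

lemma ideal_below_subset_iff: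
  "\<lbrakk>Y \<in> carrier (R_nu_monoid B); b \<in> carrier B\<rbrakk> \<Longrightarrow> \<down>b \<subseteq> Y \<longleftrightarrow> b \<in> Y"
  using R_nu_down_closed[of Y b] ideal_below_self[of b] by (auto simp: ideal_below_def)

text \<open>The finite elements are the finitely generated ones. A set \<open>X\<close> is the join of the
  principal ideals of its members, so finiteness selects finitely many generators. Conversely, each
  generator in a join of a family \<open>A\<close> is a join of finitely many elements of
  \<open>\<Union>A\<close>, and finitely many members of \<open>A\<close> contain all of these.\<close>

lemma finite_elements_R_nu_iff:
  "X \<in> finite_elements (R_nu_monoid B) \<longleftrightarrow> X \<in> carrier (R_nu_monoid B) \<and>
    (\<exists>F\<subseteq>X. finite F \<and> (\<forall>Y\<in>carrier (R_nu_monoid B). F \<subseteq> Y \<longrightarrow> X \<subseteq> Y))"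
  (is "_ \<longleftrightarrow> _ \<and> ?generated")
proof (intro iffI conjI)
  assume X: "X \<in> finite_elements (R_nu_monoid B)"
  then show Xn: "X \<in> carrier (R_nu_monoid B)" by (simp add: finite_elements_def)
  note Xc = R_nu_subset[OF Xn]
  let ?A = "ideal_below B ` X"
  have "is_join (R_nu_monoid B) ?A X"
    unfolding R_nu_join_iff
    using Xn Xc ideal_below_in_R_nu ideal_below_subset_iff ideal_below_self by blast
  moreover have "X \<preceq>\<^bsub>R_nu_monoid B\<^esub> X" using R_nu_le_iff[OF Xn Xn] by simp
  ultimately have "\<exists>A\<subseteq>?A. finite A \<and> (\<exists>K. is_join (R_nu_monoid B) A K \<and>
      X \<preceq>\<^bsub>R_nu_monoid B\<^esub> K)"
    using X unfolding finite_elements_def by blast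
  then obtain A K where A: "A \<subseteq> ?A" "finite A" and K: "is_join (R_nu_monoid B) A K"
    "X \<preceq>\<^bsub>R_nu_monoid B\<^esub> K" by blast
  obtain F where F: "F \<subseteq> X" "finite F" "A = ideal_below B ` F"
    using finite_subset_image[OF A(2,1)] by blast
  have "X \<subseteq> Y" if Y: "Y \<in> carrier (R_nu_monoid B)" "F \<subseteq> Y" for Y
  proof -
    have "\<Union>A \<subseteq> Y" using Y F Xc ideal_below_subset_iff[OF Y(1)] by blast
    then have "K \<subseteq> Y" using K(1) Y(1) unfolding R_nu_join_iff by blast
    moreover have "X \<subseteq> K" using K R_nu_le_iff[OF Xn] unfolding R_nu_join_iff by blast
    ultimately show ?thesis by blast
  qed
  then show ?generated using F by auto
next
  assume "X \<in> carrier (R_nu_monoid B) \<and> ?generated"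
  then obtain F where X: "X \<in> carrier (R_nu_monoid B)" and F: "F \<subseteq> X" "finite F"
    and least: "\<forall>Y\<in>carrier (R_nu_monoid B). F \<subseteq> Y \<longrightarrow> X \<subseteq> Y" by blast
  have "\<exists>A'\<subseteq>A. finite A' \<and> (\<exists>K. is_join (R_nu_monoid B) A' K \<and>
      X \<preceq>\<^bsub>R_nu_monoid B\<^esub> K)"
    if J: "is_join (R_nu_monoid B) A J" "X \<preceq>\<^bsub>R_nu_monoid B\<^esub> J" for A J
  proof -
    have A: "A \<subseteq> carrier (R_nu_monoid B)" and Jc: "J \<in> carrier (R_nu_monoid B)" and AJ: "\<Union>A \<subseteq> J"
      using J(1) unfolding R_nu_join_iff by blast+
    have "is_join (R_nu_monoid B) A (nucleus B (\<Union>A))" using R_nu_bounded_join[OF A Jc AJ] .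
    then have "J \<subseteq> nucleus B (\<Union>A)" using J(1) unfolding R_nu_join_iff by blast
    then have "X \<subseteq> nucleus B (\<Union>A)" using J(2) R_nu_le_iff[OF X Jc] by blast
    then have "\<forall>f\<in>F. \<exists>G. finite G \<and> G \<subseteq> \<Union>A \<and> is_join (to_rr B) G f"
      using F(1) unfolding nucleus_eq by blast
    then obtain G where G: "\<And>f. f \<in> F \<Longrightarrow> finite (G f) \<and> G f \<subseteq> \<Union>A \<and> is_join (to_rr B) (G f) f"
      by metis
    have "finite (\<Union>f\<in>F. G f)" "(\<Union>f\<in>F. G f) \<subseteq> \<Union>A" using G F(2) by auto
    then obtain A' where A': "finite A'" "A' \<subseteq> A" "(\<Union>f\<in>F. G f) \<subseteq> \<Union>A'"
      by (rule finite_subset_Union)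
    have K: "is_join (R_nu_monoid B) A' (nucleus B (\<Union>A'))"
      using R_nu_bounded_join[OF subset_trans[OF A'(2) A] Jc] Union_mono[OF A'(2)] AJ by simp
    then have Kc: "nucleus B (\<Union>A') \<in> carrier (R_nu_monoid B)" by (simp add: R_nu_join_iff)
    have "f \<in> nucleus B (\<Union>A')" if "f \<in> F" for f
      using G[OF that] A'(3) that by (intro nucleusI[of "G f"]) auto
    then have "F \<subseteq> nucleus B (\<Union>A')" by blast
    then have "X \<preceq>\<^bsub>R_nu_monoid B\<^esub> nucleus B (\<Union>A')"
      using least Kc R_nu_le_iff[OF X Kc] by simp
    then show ?thesis using K A'(1,2) by blast
  qed
  then show "X \<in> finite_elements (R_nu_monoid B)" using X by (auto simp: finite_elements_def)
qed

end

section \<open>Partial units of the companion\<close>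

context boolean_inverse_monoid
begin

lemma Etale_simps:
  "carrier (Etale B) = finite_elements (R_nu_monoid B)"
  "X \<otimes>\<^bsub>Etale B\<^esub> Y = nucleus B (X <#>\<^bsub>B\<^esub> Y)"
  "X\<^sup>\<star>\<^bsub>Etale B\<^esub> = nucleus B (star (to_rr B) ` X)"
  by (simp_all add: Etale_def R_nu_monoid_def R_monoid_def)

lemma nucleus_ideal_below: "b \<in> carrier B \<Longrightarrow> nucleus B (\<down>b) = \<down>b"
  using ideal_below_in_R_nu carrier_R_nu_iff by blast

lemma ideal_below_mult:
  assumes [simp]: "a \<in> carrier B" "b \<in> carrier B"
  shows "\<down>a \<otimes>\<^bsub>Etale B\<^esub> \<down>b = \<down>(a \<otimes> b)"
proof -
  have "\<down>a <#>\<^bsub>B\<^esub> \<down>b = \<down>(a \<otimes> b)"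
  proof
    show "\<down>a <#>\<^bsub>B\<^esub> \<down>b \<subseteq> \<down>(a \<otimes> b)"
      by (auto simp: set_mult_def ideal_below_def intro: rr.mult_mono_below)
    show "\<down>(a \<otimes> b) \<subseteq> \<down>a <#>\<^bsub>B\<^esub> \<down>b"
    proof
      fix x assume "x \<in> \<down>(a \<otimes> b)"
      then have x: "x \<in> carrier B" "x \<preceq>\<^bsub>to_rr B\<^esub> a \<otimes> b" by (simp_all add: ideal_below_def)
      then have "a \<otimes> (b \<otimes> star (to_rr B) x) = x"
        using rr.belowD[OF x(2)] by (simp add: m_assoc rr.star_closed)
      moreover have "b \<otimes> star (to_rr B) x \<in> \<down>b"
        using x by (simp add: ideal_below_def rr.mult_star_below rr.star_closed)
      ultimately show "x \<in> \<down>a <#>\<^bsub>B\<^esub> \<down>b"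
        using ideal_below_self[of a] by (force simp: set_mult_def)
    qed
  qed
  then show ?thesis by (simp add: Etale_simps nucleus_ideal_below)
qed

lemma ideal_below_star:
  assumes [simp]: "b \<in> carrier B"
  shows "(\<down>b)\<^sup>\<star>\<^bsub>Etale B\<^esub> = \<down>(star (to_rr B) b)"
proof -
  have [simp]: "star (to_rr B) b \<in> carrier B" by (simp add: rr.star_closed)
  have "star (to_rr B) ` \<down>b = \<down>(star (to_rr B) b)"
  proof
    show "star (to_rr B) ` \<down>b \<subseteq> \<down>(star (to_rr B) b)"
      by (auto simp: ideal_below_def rr.star_closed intro: rr.star_mono)
    show "\<down>(star (to_rr B) b) \<subseteq> star (to_rr B) ` \<down>b"
    proof
      fix e assume "e \<in> \<down>(star (to_rr B) b)"
      then have e [simp]: "e \<in> carrier B" and le: "e \<preceq>\<^bsub>to_rr B\<^esub> star (to_rr B) b"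
        by (simp_all add: ideal_below_def)
      have "star (to_rr B) (b \<otimes> star (to_rr B) e) = e"
        using rr.belowD[OF le] by (simp add: rr.star_mult_star)
      moreover have "b \<otimes> star (to_rr B) e \<in> \<down>b"
        by (simp add: ideal_below_def rr.mult_star_below rr.star_closed)
      ultimately show "e \<in> star (to_rr B) ` \<down>b" by force
    qed
  qed
  then show ?thesis by (simp add: Etale_simps nucleus_ideal_below)
qed

lemma ideal_below_finite: "b \<in> carrier B \<Longrightarrow> \<down>b \<in> carrier (Etale B)"
  unfolding Etale_simps finite_elements_R_nu_iff
  using ideal_below_in_R_nu[of b] ideal_below_self[of b] ideal_below_subset_iff[of _ b]
  by (intro conjI exI[of _ "{b}"]) auto

lemma ideal_below_partial_unit:
  assumes "b \<in> carrier B"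
  shows "\<down>b \<in> partial_units (Etale B)"
  unfolding partial_units_def
  using assms
  by (auto intro!: ideal_below_finite bexI[of _ "\<down>(b\<^sup>-)"] simp: ideal_below_mult ideal_below_star star_to_rr)

lemma inj_ideal_below: "inj_on (ideal_below B) (carrier B)"
proof (rule inj_onI)
  fix a b assume "a \<in> carrier B" "b \<in> carrier B" "\<down>a = \<down>b"
  then show "a = b"
    using ideal_below_self[of a] ideal_below_self[of b]
    by (auto simp: ideal_below_def intro: rr.below_antisym)
qed

text \<open>Write \<open>x\<^sup>\<star>\<close> as a finite join of products \<open>f = y \<otimes> w\<close> with
  \<open>y \<in> Y\<close> and \<open>w \<in> X\<close>; then \<open>x\<^sup>-\<close> is the join of the elements \<open>f \<otimes> x\<^sup>-\<close>.
  On the domain \<open>f\<close> the elements \<open>x\<close> and \<open>w\<close> agree, hence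
  \<open>f \<otimes> x\<^sup>- = f \<otimes> w\<^sup>- = y \<otimes> (w \<otimes> w\<^sup>-)\<close>, a restriction of \<open>y\<close>.\<close>

lemma partial_unit_ginv_mem:
  assumes X: "X \<in> carrier (R_nu_monoid B)" and Y: "Y \<in> carrier (R_nu_monoid B)"
    and YX: "Y \<otimes>\<^bsub>Etale B\<^esub> X = X\<^sup>\<star>\<^bsub>Etale B\<^esub>" and XY: "X \<otimes>\<^bsub>Etale B\<^esub> Y = Y\<^sup>\<star>\<^bsub>Etale B\<^esub>"
    and x: "x \<in> X"
  shows "x\<^sup>- \<in> Y"
proof -
  let ?e = "star (to_rr B) x"
  have Xc: "X \<subseteq> carrier B" and Yc: "Y \<subseteq> carrier B" using X Y R_nu_subset by blast+
  have [simp]: "x \<in> carrier B" using x Xc by blast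
  have "star (to_rr B) ` X \<subseteq> carrier B" using Xc by (auto intro: rr.star_closed)
  then have "?e \<in> nucleus B (star (to_rr B) ` X)"
    using x nucleus_increasing by blast
  then have "?e \<in> nucleus B (Y <#>\<^bsub>B\<^esub> X)" using YX by (simp add: Etale_simps)
  then obtain F where F: "finite F" "F \<subseteq> Y <#>\<^bsub>B\<^esub> X" "is_join (to_rr B) F ?e" by (rule nucleusE)
  have "is_join (to_rr B) ((\<lambda>f. f \<otimes> x\<^sup>-) ` F) (?e \<otimes> x\<^sup>-)"
    by (rule rr.finite_join_mult_right[OF F(1,3)]) simp
  then have "is_join (to_rr B) ((\<lambda>f. f \<otimes> x\<^sup>-) ` F) (x\<^sup>-)"
    by (simp add: star_to_rr ginv_mult_ginv)
  moreover have "(\<lambda>f. f \<otimes> x\<^sup>-) ` F \<subseteq> Y"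
  proof clarify
    fix f assume f: "f \<in> F"
    then obtain y w where yw: "y \<in> Y" "w \<in> X" "f = y \<otimes> w" using F(2) by (auto simp: set_mult_def)
    then have [simp]: "y \<in> carrier B" "w \<in> carrier B" using Xc Yc by auto
    have fe: "f \<preceq>\<^bsub>to_rr B\<^esub> ?e" by (rule rr.is_join_upper[OF F(3) f])
    have fc [simp]: "f \<in> carrier B" using yw by simp
    have "star (to_rr B) f = f" by (rule rr.below_star_imp_star_eq[OF fe]) auto
    then have fi: "f \<in> idempotents B" using star_in_idempotents[OF fc] by simp
    have xy: "x \<otimes> y \<in> idempotents B"
    proof -
      have "X <#>\<^bsub>B\<^esub> Y \<subseteq> carrier B" using Xc Yc by (auto simp: set_mult_def)
      then have "x \<otimes> y \<in> X \<otimes>\<^bsub>Etale B\<^esub> Y"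
        unfolding Etale_simps using x yw nucleus_increasing[of "X <#>\<^bsub>B\<^esub> Y"] by (auto simp: set_mult_def)
      then show ?thesis
        using R_nu_star_idempotents[OF Yc] XY by (simp add: Etale_simps star_R_nu)
    qed
    \<comment> \<open>As \<open>x \<otimes> y\<close> is idempotent, \<open>x \<otimes> f = x \<otimes> y \<otimes> w\<close> lies below \<open>w\<close>; its domain is \<open>f\<close>.\<close>
    have "x \<otimes> f = w \<otimes> f"
    proof -
      have fw: "f \<otimes> star (to_rr B) w = f"
        unfolding yw(3) by (simp add: m_assoc rr.RR4 rr.star_closed)
      have "x \<otimes> f = x \<otimes> y \<otimes> w" using yw by (simp add: m_assoc)
      also have "\<dots> \<preceq>\<^bsub>to_rr B\<^esub> \<one> \<otimes> w"
        using xy by (intro rr.mult_mono_below) (auto simp: rr.below_refl simp flip: idempotent_iff_below_one)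
      finally have le: "x \<otimes> f \<preceq>\<^bsub>to_rr B\<^esub> w" by simp
      have "star (to_rr B) (x \<otimes> f) = ?e \<otimes> f"
        using rr.star_mult_star[of x f] \<open>star (to_rr B) f = f\<close> by simp
      also have "\<dots> = f" using rr.belowD[OF fe] \<open>star (to_rr B) f = f\<close> by simp
      finally show ?thesis using rr.belowD[OF le] by simp
    qed
    then have "f \<otimes> x\<^sup>- = f \<otimes> w\<^sup>-"
      using ginv_idempotent[OF fi] ginv_mult[of x f] ginv_mult[of w f] by simp
    also have "\<dots> = y \<otimes> (w \<otimes> w\<^sup>-)" using yw by (simp add: m_assoc)
    finally have eq: "f \<otimes> x\<^sup>- = y \<otimes> (w \<otimes> w\<^sup>-)" .
    have "y \<otimes> (w \<otimes> w\<^sup>-) \<preceq>\<^bsub>to_rr B\<^esub> y"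
      using rr.mult_star_below[of y "w \<otimes> w\<^sup>-"] star_idempotent[of "w \<otimes> w\<^sup>-"]
      by (simp add: idempotent_mult_ginv)
    then show "f \<otimes> x\<^sup>- \<in> Y" using R_nu_down_closed[OF Y yw(1)] eq by simp
  qed
  ultimately show ?thesis using F(1) by (intro R_nu_join_closed[OF Y]) auto
qed

text \<open>For \<open>x\<close> and \<open>w\<close> in \<open>X\<close>, the element \<open>x\<^sup>- \<otimes> w\<close> belongs to
  \<open>Y \<cdot> X = X\<^sup>\<circ>\<close>, which consists of idempotents. Hence \<open>X\<close> is compatible, and its finite
  generating set has a join.\<close>

lemma partial_unit_principal:
  assumes "X \<in> partial_units (Etale B)"
  shows "\<exists>b\<in>carrier B. X = \<down>b"
proof -
  obtain Y where fin: "X \<in> carrier (Etale B)" "Y \<in> carrier (Etale B)"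
    and YX: "Y \<otimes>\<^bsub>Etale B\<^esub> X = X\<^sup>\<star>\<^bsub>Etale B\<^esub>" and XY: "X \<otimes>\<^bsub>Etale B\<^esub> Y = Y\<^sup>\<star>\<^bsub>Etale B\<^esub>"
    using assms by (auto simp: partial_units_def)
  then have X: "X \<in> carrier (R_nu_monoid B)" and Y: "Y \<in> carrier (R_nu_monoid B)"
    by (simp_all add: Etale_simps finite_elements_def)
  have Xc: "X \<subseteq> carrier B" and Yc: "Y \<subseteq> carrier B" using X Y R_nu_subset by blast+
  obtain F where F: "F \<subseteq> X" "finite F"
    and least: "\<forall>Z\<in>carrier (R_nu_monoid B). F \<subseteq> Z \<longrightarrow> X \<subseteq> Z"
    using fin(1) unfolding Etale_simps finite_elements_R_nu_iff by blast
  have "compatible B x w" if x: "x \<in> X" and w: "w \<in> X" for x w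
  proof -
    have "x\<^sup>- \<in> Y" using partial_unit_ginv_mem[OF X Y YX XY x] .
    moreover have "Y <#>\<^bsub>B\<^esub> X \<subseteq> carrier B" using Xc Yc by (auto simp: set_mult_def)
    ultimately have "x\<^sup>- \<otimes> w \<in> Y \<otimes>\<^bsub>Etale B\<^esub> X"
      unfolding Etale_simps using w nucleus_increasing[of "Y <#>\<^bsub>B\<^esub> X"] by (auto simp: set_mult_def)
    then have "x\<^sup>- \<otimes> w \<in> idempotents B"
      using R_nu_star_idempotents[OF Xc] YX by (simp add: Etale_simps star_R_nu)
    moreover have "x \<otimes> w\<^sup>- \<in> idempotents B"
      using R_nu_left_compatible[OF X x w] left_compatible_iff[of x w] x w Xc by auto
    ultimately show ?thesis by (simp add: compatible_def)
  qed
  then obtain b where b: "is_join (to_rr B) F b"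
    using compatible_finite_join[of F] F Xc by blast
  have bc: "b \<in> carrier B" by (rule rr.is_join_carrier[OF b])
  have "b \<in> X" using R_nu_join_closed[OF X F(2,1) b] .
  moreover have "F \<subseteq> \<down>b" using rr.is_join_upper[OF b] F Xc by (auto simp: ideal_below_def)
  ultimately have "X = \<down>b"
    using least ideal_below_in_R_nu[OF bc] ideal_below_subset_iff[OF X bc] by auto
  then show ?thesis using bc by blast
qed

lemma ideal_below_iso: "ideal_below B \<in> iso B (Inv (Etale B))"
proof (rule isoI)
  show "ideal_below B \<in> hom B (Inv (Etale B))"
    by (rule homI) (simp_all add: Inv_def ideal_below_partial_unit ideal_below_mult)
  show "bij_betw (ideal_below B) (carrier B) (carrier (Inv (Etale B)))"
    using inj_ideal_below ideal_below_partial_unit partial_unit_principal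
    by (auto simp: bij_betw_def Inv_def)
qed

end

section \<open>Finite joins in Boolean right restriction monoids\<close>

text \<open>The natural orders of \<open>S\<close> and of its monoid of partial units come from different star
  operations that agree on partial units; this transfers the Boolean algebra axioms between them.\<close>

lemma boolean_algebra_order_cong:
  assumes "boolean_algebra_order L" and car: "carrier L' = carrier L" and eq: "eq L' = eq L"
    and le: "\<And>x y. \<lbrakk>x \<in> carrier L; y \<in> carrier L\<rbrakk> \<Longrightarrow> x \<sqsubseteq>\<^bsub>L'\<^esub> y \<longleftrightarrow> x \<sqsubseteq>\<^bsub>L\<^esub> y"
  shows "boolean_algebra_order L'"
proof -
  interpret L: boolean_algebra_order L by fact
  have upper: "Upper L' A = Upper L A" and lower: "Lower L' A = Lower L A" for A
    unfolding Upper_def Lower_def car using le by auto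
  have least: "least L' x A = least L x A" and greatest: "greatest L' x A = greatest L x A" for x A
    unfolding least_def greatest_def car using le by (auto simp: subset_iff)
  have join: "x \<squnion>\<^bsub>L'\<^esub> y = x \<squnion>\<^bsub>L\<^esub> y" and meet: "x \<sqinter>\<^bsub>L'\<^esub> y = x \<sqinter>\<^bsub>L\<^esub> y" for x y
    by (simp_all add: join_def meet_def sup_def inf_def upper lower least greatest)
  have bot: "\<bottom>\<^bsub>L'\<^esub> = \<bottom>\<^bsub>L\<^esub>" and top: "\<top>\<^bsub>L'\<^esub> = \<top>\<^bsub>L\<^esub>"
    by (simp_all add: bottom_def top_def car least greatest)
  show ?thesis
  proof unfold_locales
    show "x \<sqinter>\<^bsub>L'\<^esub> (y \<squnion>\<^bsub>L'\<^esub> z) = x \<sqinter>\<^bsub>L'\<^esub> y \<squnion>\<^bsub>L'\<^esub> (x \<sqinter>\<^bsub>L'\<^esub> z)"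
      if "x \<in> carrier L'" "y \<in> carrier L'" "z \<in> carrier L'" for x y z
      using that by (simp add: join meet car L.meet_join_distrib)
    show "\<exists>y\<in>carrier L'. x \<sqinter>\<^bsub>L'\<^esub> y = \<bottom>\<^bsub>L'\<^esub> \<and> x \<squnion>\<^bsub>L'\<^esub> y = \<top>\<^bsub>L'\<^esub>" if "x \<in> carrier L'" for x
      using that L.complement_exists by (simp add: join meet car bot top)
    show "\<exists>s. least L' s (Upper L' {x, y})" if "x \<in> carrier L'" "y \<in> carrier L'" for x y
      using that L.sup_of_two_exists by (simp add: car upper least)
    show "\<exists>s. greatest L' s (Lower L' {x, y})" if "x \<in> carrier L'" "y \<in> carrier L'" for x y
      using that L.inf_of_two_exists by (simp add: car lower greatest)
    show "\<exists>x. least L' x (carrier L')" "\<exists>x. greatest L' x (carrier L')"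
      using L.bottom_exists L.top_exists by (simp_all add: car least greatest)
    show "x \<sqsubseteq>\<^bsub>L'\<^esub> z"
      if "x \<sqsubseteq>\<^bsub>L'\<^esub> y" "y \<sqsubseteq>\<^bsub>L'\<^esub> z" "x \<in> carrier L'" "y \<in> carrier L'" "z \<in> carrier L'" for x y z
      using that L.le_trans[of x y z] by (simp add: car le)
  qed (use L.eq_is_equal in \<open>auto simp: car le eq\<close>)
qed

context boolean_rr_monoid
begin

lemma bounded_binary_join:
  assumes "a \<in> carrier S" "b \<in> carrier S" "u \<in> carrier S" "a \<preceq> u" "b \<preceq> u"
  shows "\<exists>j. is_join S {a, b} j"
  using binary_join_exists bounded_imp_left_compatible[of a u b] assms by blast

lemma binary_join_star:
  assumes "is_join S {a, b} j"
  shows "is_join S {a\<^sup>\<star>, b\<^sup>\<star>} (j\<^sup>\<star>)"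
proof -
  have "a \<in> carrier S" "b \<in> carrier S" using is_join_subset[OF assms] by auto
  then obtain e where "is_join S {a\<^sup>\<star>, b\<^sup>\<star>} e"
    using binary_join_exists[OF _ _ left_compatible_star[of a b]] by (auto simp: star_closed)
  then show ?thesis using star_of_join[OF assms, of e] by simp
qed

lemma binary_join_left_compatible:
  assumes "is_join S {a, b} j"
  shows "left_compatible S a b"
  using is_join_subset[OF assms] is_join_carrier[OF assms]
  by (intro bounded_imp_left_compatible[of a j b] is_join_upper[OF assms]) auto

text \<open>The pair \<open>c \<otimes> a\<close>, \<open>c \<otimes> b\<close> has the upper bound \<open>c \<otimes> j\<close>, hence a join
  \<open>y\<close> below it. Restrictions of \<open>c \<otimes> j\<close> are compared by their domains, so it is enough that
  the domain \<open>d\<close> of \<open>c \<otimes> j\<close> lies below \<open>y\<^sup>\<star>\<close>. Distributivity from the right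
  splits \<open>d = j\<^sup>\<star> \<otimes> d\<close> into \<open>a\<^sup>\<star> \<otimes> d = (c \<otimes> a)\<^sup>\<star>\<close> and \<open>b\<^sup>\<star> \<otimes> d = (c \<otimes> b)\<^sup>\<star>\<close>.\<close>

lemma binary_join_mult_left:
  assumes c [simp]: "c \<in> carrier S" and j: "is_join S {a, b} j"
  shows "is_join S {c \<otimes> a, c \<otimes> b} (c \<otimes> j)"
proof -
  have [simp]: "a \<in> carrier S" "b \<in> carrier S" "j \<in> carrier S"
    using is_join_subset[OF j] is_join_carrier[OF j] by auto
  have le: "c \<otimes> a \<preceq> c \<otimes> j" "c \<otimes> b \<preceq> c \<otimes> j"
    by (intro mult_mono_below below_refl is_join_upper[OF j]; simp)+
  then obtain y where y: "is_join S {c \<otimes> a, c \<otimes> b} y"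
    using bounded_binary_join[of "c \<otimes> a" "c \<otimes> b" "c \<otimes> j"] by auto
  have yc [simp]: "y \<in> carrier S" by (rule is_join_carrier[OF y])
  have ycj: "y \<preceq> c \<otimes> j" using le by (intro is_join_least[OF y]) auto
  have cjj: "c \<otimes> j \<preceq> c \<otimes> j" by (simp add: below_refl)
  let ?d = "(c \<otimes> j)\<^sup>\<star>"
  have dc [simp]: "?d \<in> carrier S" by (simp add: star_closed)
  have part: "x\<^sup>\<star> \<otimes> ?d \<preceq> y\<^sup>\<star>" if x: "x = a \<or> x = b" for x
  proof -
    have [simp]: "x \<in> carrier S" using x by auto
    have xj: "x \<preceq> j" using x is_join_upper[OF j] by auto
    have "x\<^sup>\<star> \<otimes> ?d = (c \<otimes> j \<otimes> x\<^sup>\<star>)\<^sup>\<star>" by (simp add: star_mult_star RR3[of x])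
    also have "c \<otimes> j \<otimes> x\<^sup>\<star> = c \<otimes> x" using belowD[OF xj] by (simp add: m_assoc star_closed)
    also have "(c \<otimes> x)\<^sup>\<star> \<preceq> y\<^sup>\<star>" using x by (intro star_mono is_join_upper[OF y]) auto
    finally show ?thesis .
  qed
  have dj: "is_join S {a\<^sup>\<star> \<otimes> ?d, b\<^sup>\<star> \<otimes> ?d} (j\<^sup>\<star> \<otimes> ?d)"
    by (rule binary_join_mult_right[OF _ _ _ _ binary_join_star[OF j]])
      (simp_all add: star_closed left_compatible_star)
  have "j\<^sup>\<star> \<otimes> ?d \<preceq> y\<^sup>\<star>"
    by (rule is_join_least[OF dj]) (use part in \<open>auto simp: star_closed\<close>)
  also have "j\<^sup>\<star> \<otimes> ?d = ?d" using star_mult_absorb[of c j] RR3[of j "c \<otimes> j"] by simp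
  finally have "c \<otimes> j \<preceq> y" 
    by (rule below_if_star_below[OF cjj ycj]) simp_all
  then have "y = c \<otimes> j" using ycj by (intro below_antisym) auto
  then show ?thesis using y by simp
qed

lemma finite_join_rr_monoid: "finite_join_rr_monoid S"
proof unfold_locales
  interpret L: boolean_algebra_order "(nat_order S)\<lparr>carrier := Proj S\<rparr>" by (rule Proj_boolean)
  show "\<exists>z. is_zero S z \<and> z\<^sup>\<star> = z"
    using bottom_zero L.bottom_closed by (auto simp: Proj_def)
  show "is_join S {a \<otimes> c, b \<otimes> c} (j \<otimes> c)" if "c \<in> carrier S" "is_join S {a, b} j" for a b c j
    using that binary_join_mult_right binary_join_left_compatible[OF that(2)] is_join_subset[OF that(2)]
    by auto
qed (auto intro: bounded_binary_join binary_join_mult_left)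

end

sublocale boolean_rr_monoid \<subseteq> finite_join_rr_monoid S
  by (rule finite_join_rr_monoid)

context boolean_rr_monoid
begin

lemma left_compatible_finite_join:
  assumes "finite F" "F \<subseteq> carrier S" "\<And>x y. x \<in> F \<Longrightarrow> y \<in> F \<Longrightarrow> left_compatible S x y"
  shows "\<exists>j. is_join S F j"
  using assms
proof (induction F rule: finite_induct)
  case empty
  then show ?case using is_join_empty zero_projection by blast
next
  case (insert a F)
  then obtain k where k: "is_join S F k" by blast
  have a: "a \<in> carrier S" using insert.prems(1) by auto
  have "left_compatible S k a" using insert.prems(2) a by (intro left_compatible_join[OF insert.hyps(1) k]) auto
  then obtain j where "is_join S {a, k} j"
    using binary_join_exists left_compatible_sym a is_join_carrier[OF k] by blast
  then show ?case using is_join_insert[OF k] by blast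
qed

end

section \<open>The Boolean inverse monoid of partial units\<close>

lemma Inv_simps [simp]:
  "carrier (Inv S) = partial_units S" "mult (Inv S) = mult S" "one (Inv S) = one S"
  by (simp_all add: Inv_def)

context right_restriction_monoid
begin

lemma partial_unitI:
  "\<lbrakk>a \<in> carrier S; b \<in> carrier S; b \<otimes> a = a\<^sup>\<star>; a \<otimes> b = b\<^sup>\<star>\<rbrakk> \<Longrightarrow> a \<in> partial_units S"
  by (auto simp: partial_units_def)

lemma partial_unitE:
  assumes "a \<in> partial_units S"
  obtains b where "b \<in> partial_units S" "b \<otimes> a = a\<^sup>\<star>" "a \<otimes> b = b\<^sup>\<star>"
  using assms by (auto simp: partial_units_def)

lemma partial_units_closed: "a \<in> partial_units S \<Longrightarrow> a \<in> carrier S"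
  by (simp add: partial_units_def)

lemma partial_unit_inverse_mult:
  "\<lbrakk>a \<in> carrier S; b \<in> carrier S; b \<otimes> a = a\<^sup>\<star>\<rbrakk> \<Longrightarrow> a \<otimes> b \<otimes> a = a"
  by (simp only: m_assoc RR4)

lemma partial_units_mult_closed:
  assumes "a \<in> partial_units S" "c \<in> partial_units S"
  shows "a \<otimes> c \<in> partial_units S"
proof -
  have aux: "(d \<otimes> b) \<otimes> (a \<otimes> c) = (a \<otimes> c)\<^sup>\<star>"
    if "b \<otimes> a = a\<^sup>\<star>" "d \<otimes> c = c\<^sup>\<star>"
      "a \<in> carrier S" "b \<in> carrier S" "c \<in> carrier S" "d \<in> carrier S" for a b c d
  proof -
    have "(d \<otimes> b) \<otimes> (a \<otimes> c) = d \<otimes> ((b \<otimes> a) \<otimes> c)" using that(3-6) by (simp add: m_assoc)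
    also have "\<dots> = d \<otimes> (c \<otimes> (a \<otimes> c)\<^sup>\<star>)" using that by (simp add: RR6)
    also have "\<dots> = c\<^sup>\<star> \<otimes> (a \<otimes> c)\<^sup>\<star>" using that by (simp add: star_closed flip: m_assoc)
    also have "\<dots> = (a \<otimes> c)\<^sup>\<star> \<otimes> c\<^sup>\<star>" using that by (simp add: RR3)
    also have "\<dots> = (a \<otimes> c)\<^sup>\<star>" using that by (simp add: star_mult_absorb)
    finally show ?thesis .
  qed
  obtain b where b: "b \<in> partial_units S" "b \<otimes> a = a\<^sup>\<star>" "a \<otimes> b = b\<^sup>\<star>"
    using assms(1) by (rule partial_unitE)
  obtain d where d: "d \<in> partial_units S" "d \<otimes> c = c\<^sup>\<star>" "c \<otimes> d = d\<^sup>\<star>"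
    using assms(2) by (rule partial_unitE)
  note cl = assms[THEN partial_units_closed] b(1)[THEN partial_units_closed] d(1)[THEN partial_units_closed]
  show ?thesis
    using aux[OF b(2) d(2)] aux[OF d(3) b(3)] cl by (intro partial_unitI[of _ "d \<otimes> b"]) auto
qed

lemma Proj_partial_units: "e \<in> Proj S \<Longrightarrow> e \<in> partial_units S"
  using star_idem[of e] by (intro partial_unitI[of e e]) (auto simp: Proj_def)

lemma star_Proj: "a \<in> carrier S \<Longrightarrow> a\<^sup>\<star> \<in> Proj S"
  by (simp add: Proj_def star_closed RR1)

lemma partial_units_down_closed:
  assumes "a \<preceq> b" "b \<in> partial_units S" "a \<in> carrier S"
  shows "a \<in> partial_units S"
  using belowD[OF assms(1)] partial_units_mult_closed[OF assms(2) Proj_partial_units[OF star_Proj[OF assms(3)]]]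
  by simp

text \<open>If \<open>a \<otimes> a = a\<close> and \<open>b \<otimes> a = a\<^sup>\<star>\<close>, then
  \<open>a\<^sup>\<star> = b \<otimes> a \<otimes> a = a\<^sup>\<star> \<otimes> a\<close>, and (RR6) turns the right-hand side into
  \<open>a \<otimes> (a \<otimes> a)\<^sup>\<star> = a\<close>.\<close>

lemma idempotents_Inv: "idempotents (Inv S) = Proj S"
proof
  show "Proj S \<subseteq> idempotents (Inv S)"
  proof
    fix e assume e: "e \<in> Proj S"
    then have "e \<otimes> e = e" using star_idem[of e] by (simp add: Proj_def)
    then show "e \<in> idempotents (Inv S)" using Proj_partial_units[OF e] by (simp add: idempotents_def)
  qed
  show "idempotents (Inv S) \<subseteq> Proj S"
  proof
    fix a assume "a \<in> idempotents (Inv S)"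
    then have a: "a \<in> partial_units S" and aa: "a \<otimes> a = a" by (simp_all add: idempotents_def)
    obtain b where b: "b \<in> partial_units S" "b \<otimes> a = a\<^sup>\<star>" using a by (rule partial_unitE)
    note [simp] = a[THEN partial_units_closed] b(1)[THEN partial_units_closed]
    have "a\<^sup>\<star> = b \<otimes> (a \<otimes> a)" using aa b(2) by simp
    also have "\<dots> = a\<^sup>\<star> \<otimes> a" using b(2) by (simp flip: m_assoc)
    also have "\<dots> = a \<otimes> (a \<otimes> a)\<^sup>\<star>" by (rule RR6) auto
    also have "\<dots> = a" using aa by (simp add: RR4)
    finally show "a \<in> Proj S" by (simp add: Proj_def)
  qed
qed

text \<open>The usual argument that commuting idempotents make inverses unique: two inverses \<open>b\<close> and
  \<open>c\<close> of \<open>a\<close> both equal \<open>b \<otimes> a \<otimes> c\<close>.\<close>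

lemma inverse_monoid_Inv: "inverse_monoid (Inv S)"
proof -
  have "\<one> \<in> partial_units S" by (rule Proj_partial_units) (simp add: Proj_def star_one)
  then have "monoid (Inv S)"
    by (intro monoidI) (simp_all add: partial_units_closed partial_units_mult_closed m_assoc)
  moreover have "inverse_monoid_axioms (Inv S)"
  proof (unfold_locales, unfold Inv_simps)
    fix a assume a: "a \<in> partial_units S"
    obtain b where b: "b \<in> partial_units S" "b \<otimes> a = a\<^sup>\<star>" "a \<otimes> b = b\<^sup>\<star>" using a by (rule partial_unitE)
    note [simp] = partial_units_closed
    have ba: "a \<otimes> b \<otimes> a = a" "b \<otimes> a \<otimes> b = b"
      using a b partial_unit_inverse_mult[of a b] partial_unit_inverse_mult[of b a] by simp_all
    show "\<exists>!b. b \<in> partial_units S \<and> a \<otimes> b \<otimes> a = a \<and> b \<otimes> a \<otimes> b = b"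
    proof (rule ex1I[of _ b])
      fix c assume "c \<in> partial_units S \<and> a \<otimes> c \<otimes> a = a \<and> c \<otimes> a \<otimes> c = c"
      then have c: "c \<in> partial_units S" and ca: "a \<otimes> c \<otimes> a = a" "c \<otimes> a \<otimes> c = c" by simp_all
      have idem: "x \<otimes> y \<in> Proj S"
        if "x \<in> partial_units S" "y \<in> partial_units S" "x \<otimes> y \<otimes> x = x" for x y
      proof -
        have "(x \<otimes> y) \<otimes> (x \<otimes> y) = x \<otimes> y \<otimes> x \<otimes> y"
          using that(1,2) by (simp add: m_assoc)
        then have "x \<otimes> y \<in> idempotents (Inv S)"
          using that by (simp add: idempotents_def partial_units_mult_closed)
        then show ?thesis by (simp add: idempotents_Inv)
      qed
      have comm: "e \<otimes> f = f \<otimes> e" if "e \<in> Proj S" "f \<in> Proj S" for e f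
        using that RR3[of e f] by (simp add: Proj_def)
      have "c = c \<otimes> (a \<otimes> b \<otimes> a) \<otimes> c" using ba ca by simp
      also have "\<dots> = (c \<otimes> a) \<otimes> (b \<otimes> a) \<otimes> c" using a b(1) c by (simp add: m_assoc)
      also have "(c \<otimes> a) \<otimes> (b \<otimes> a) = (b \<otimes> a) \<otimes> (c \<otimes> a)"
        using a b(1) c ba ca by (intro comm idem)
      also have "(b \<otimes> a) \<otimes> (c \<otimes> a) \<otimes> c = b \<otimes> a \<otimes> (c \<otimes> a \<otimes> c)" using a b(1) c by (simp add: m_assoc)
      also have "\<dots> = b \<otimes> a \<otimes> c" using ca by simp
      finally have 1: "c = b \<otimes> a \<otimes> c" .
      have "b = b \<otimes> (a \<otimes> c \<otimes> a) \<otimes> b" using ba ca by simp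
      also have "\<dots> = b \<otimes> ((a \<otimes> c) \<otimes> (a \<otimes> b))" using a b(1) c by (simp add: m_assoc)
      also have "(a \<otimes> c) \<otimes> (a \<otimes> b) = (a \<otimes> b) \<otimes> (a \<otimes> c)"
        using a b(1) c ba ca by (intro comm idem)
      also have "b \<otimes> ((a \<otimes> b) \<otimes> (a \<otimes> c)) = (b \<otimes> a \<otimes> b) \<otimes> a \<otimes> c" using a b(1) c by (simp add: m_assoc)
      also have "\<dots> = b \<otimes> a \<otimes> c" using ba by simp
      finally show "c = b" using 1 by simp
    qed (use b(1) ba in simp)
  qed
  ultimately show ?thesis by (simp add: inverse_monoid_def)
qed

interpretation I: inverse_monoid "Inv S"
  rewrites "carrier (Inv S) = partial_units S" and "mult (Inv S) = mult S" and "one (Inv S) = one S"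
  by (simp_all add: inverse_monoid_Inv)

lemma
  assumes a: "a \<in> partial_units S"
  shows ginv_Inv_mult: "ginv (Inv S) a \<otimes> a = a\<^sup>\<star>"
    and mult_ginv_Inv: "a \<otimes> ginv (Inv S) a = (ginv (Inv S) a)\<^sup>\<star>"
proof -
  obtain b where b: "b \<in> partial_units S" "b \<otimes> a = a\<^sup>\<star>" "a \<otimes> b = b\<^sup>\<star>" using a by (rule partial_unitE)
  have "ginv (Inv S) a = b"
    using a b partial_unit_inverse_mult[of a b] partial_unit_inverse_mult[of b a]
    by (intro I.ginv_eqI) (simp_all add: partial_units_closed)
  then show "ginv (Inv S) a \<otimes> a = a\<^sup>\<star>" "a \<otimes> ginv (Inv S) a = (ginv (Inv S) a)\<^sup>\<star>"
    using b by simp_all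
qed

lemma star_Inv: "a \<in> partial_units S \<Longrightarrow> star (to_rr (Inv S)) a = a\<^sup>\<star>"
  by (simp add: star_to_rr ginv_Inv_mult)

lemma below_Inv: "a \<in> partial_units S \<Longrightarrow> a \<preceq>\<^bsub>to_rr (Inv S)\<^esub> b \<longleftrightarrow> a \<preceq> b"
  by (simp add: nat_le_iff star_Inv)

lemma left_compatible_Inv:
  "\<lbrakk>a \<in> partial_units S; b \<in> partial_units S\<rbrakk> \<Longrightarrow>
    left_compatible (to_rr (Inv S)) a b \<longleftrightarrow> left_compatible S a b"
  by (simp add: left_compatible_def star_Inv)

lemma is_join_InvI:
  assumes "F \<subseteq> partial_units S" "j \<in> partial_units S" "is_join S F j"
  shows "is_join (to_rr (Inv S)) F j"
  using assms is_join_upper[OF assms(3)] is_join_least[OF assms(3)]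
  by (intro I.rr.is_joinI) (auto simp: below_Inv partial_units_closed subset_iff)

end

context boolean_rr_monoid
begin

interpretation I: inverse_monoid "Inv S"
  rewrites "carrier (Inv S) = partial_units S" and "mult (Inv S) = mult S" and "one (Inv S) = one S"
  by (simp_all add: inverse_monoid_Inv)

text \<open>A finite set with a join among the partial units is bounded, so it also has a join in
  \<open>S\<close>; this lies below the former and is a partial unit too, as these form a down-closed
  set.\<close>

lemma is_join_Inv_iff:
  assumes "finite F"
  shows "is_join (to_rr (Inv S)) F j \<longleftrightarrow> F \<subseteq> partial_units S \<and> j \<in> partial_units S \<and> is_join S F j"
proof
  assume j: "is_join (to_rr (Inv S)) F j"
  have F: "F \<subseteq> partial_units S" and jc: "j \<in> partial_units S"
    using I.rr.is_join_subset[OF j] I.rr.is_join_carrier[OF j] by auto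
  have ub: "f \<preceq> j" if "f \<in> F" for f using I.rr.is_join_upper[OF j that] that F by (auto simp: below_Inv)
  obtain k where k: "is_join S F k"
    using bounded_finite_join[OF assms, of j] F jc ub partial_units_closed by blast
  have "k \<preceq> j" using ub jc by (intro is_join_least[OF k]) (auto simp: partial_units_closed)
  then have "k \<in> partial_units S" using jc is_join_carrier[OF k] by (rule partial_units_down_closed)
  then have "is_join (to_rr (Inv S)) F k" using is_join_InvI F k by blast
  then have "j = k" using j I.rr.is_join_unique by blast
  then show "F \<subseteq> partial_units S \<and> j \<in> partial_units S \<and> is_join S F j" using F jc k by simp
qed (auto intro: is_join_InvI)

text \<open>The inverse of the join \<open>j\<close> is the join \<open>k\<close> of the inverses. Expanding
  \<open>k \<otimes> j\<close> by distributivity gives \<open>a\<^sup>\<star>\<close>, \<open>b\<^sup>\<star>\<close> and the mixed products, which are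
  projections by compatibility. So \<open>k \<otimes> j\<close> is a projection; it lies above both domains and
  below \<open>j\<^sup>\<star>\<close>, hence equals \<open>j\<^sup>\<star>\<close>.\<close>

lemma join_compatible_partial_units:
  assumes a: "a \<in> partial_units S" and b: "b \<in> partial_units S"
    and comp: "compatible (Inv S) a b" and j: "is_join S {a, b} j"
  shows "j \<in> partial_units S"
proof -
  let ?a = "ginv (Inv S) a" and ?b = "ginv (Inv S) b"
  have au: "?a \<in> partial_units S" and bu: "?b \<in> partial_units S" using a b by simp_all
  note [simp] = a b au bu partial_units_closed
  have jc [simp]: "j \<in> carrier S" by (rule is_join_carrier[OF j])
  have "?a \<otimes> b \<in> idempotents (Inv S)" using comp by (simp add: compatible_def)
  then have "left_compatible S ?a ?b"
    using I.left_compatible_iff[OF au bu] left_compatible_Inv[OF au bu] by simp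
  then obtain k where k: "is_join S {?a, ?b} k" using binary_join_exists by force
  have kc [simp]: "k \<in> carrier S" by (rule is_join_carrier[OF k])
  \<comment> \<open>The hypotheses are symmetric, so one calculation covers both \<open>k \<otimes> j\<close> and \<open>j \<otimes> k\<close>.\<close>
  have half: "l \<otimes> j = j\<^sup>\<star>"
    if l: "is_join S {c, d} l" and j: "is_join S {a, b} j"
      and ca: "c \<otimes> a = a\<^sup>\<star>" and db: "d \<otimes> b = b\<^sup>\<star>"
      and cb: "c \<otimes> b \<preceq> \<one>" and da: "d \<otimes> a \<preceq> \<one>"
    for a b c d j l
  proof -
    have [simp]: "a \<in> carrier S" "b \<in> carrier S" "c \<in> carrier S" "d \<in> carrier S"
      "j \<in> carrier S" "l \<in> carrier S"
      using is_join_subset[OF j] is_join_subset[OF l] is_join_carrier[OF j] is_join_carrier[OF l] by auto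
    have one: "x \<otimes> j \<preceq> \<one>" if x: "x = c \<or> x = d" for x
    proof -
      have "x \<in> carrier S" using x by auto
      then have "is_join S {x \<otimes> a, x \<otimes> b} (x \<otimes> j)" by (rule binary_join_mult_left[OF _ j])
      moreover have "a\<^sup>\<star> \<preceq> \<one>" "b\<^sup>\<star> \<preceq> \<one>" by (simp_all add: below_one_iff star_closed RR1)
      then have "y \<preceq> \<one>" if "y \<in> {x \<otimes> a, x \<otimes> b}" for y using that x ca cb da db by auto
      ultimately show ?thesis by (rule is_join_least[OF _ one_closed])
    qed
    have "l \<otimes> j \<preceq> \<one>"
      by (rule is_join_least[OF join_mult_right[OF _ l]]) (use one in auto)
    then have lj: "(l \<otimes> j)\<^sup>\<star> = l \<otimes> j" by (simp add: below_one_iff)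
    have "l \<otimes> j \<otimes> j\<^sup>\<star> = l \<otimes> j" by (simp add: m_assoc RR4 star_closed)
    then have "l \<otimes> j \<preceq> j\<^sup>\<star>"
      using lj RR3[of j "l \<otimes> j"] by (simp add: nat_le_iff)
    moreover have "j\<^sup>\<star> \<preceq> l \<otimes> j"
    proof (rule is_join_least[OF binary_join_star[OF j]])
      have "c \<otimes> a \<preceq> l \<otimes> j" "d \<otimes> b \<preceq> l \<otimes> j"
        using is_join_upper[OF j] is_join_upper[OF l] by (auto intro: mult_mono_below)
      then show "x \<preceq> l \<otimes> j" if "x \<in> {a\<^sup>\<star>, b\<^sup>\<star>}" for x using that ca db by auto
    qed simp
    ultimately show ?thesis by (intro below_antisym) (auto simp: star_closed)
  qed
  have le1: "x \<preceq> \<one>" if "x \<in> idempotents (Inv S)" for x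
    using that by (simp add: idempotents_Inv Proj_def below_one_iff)
  have p: "?a \<otimes> b \<in> idempotents (Inv S)" "a \<otimes> ?b \<in> idempotents (Inv S)"
    using comp by (simp_all add: compatible_def)
  have q: "?b \<otimes> a \<in> idempotents (Inv S)" "b \<otimes> ?a \<in> idempotents (Inv S)"
    using p I.ginv_idempotent[OF p(1)] I.ginv_idempotent[OF p(2)] by (simp_all add: I.ginv_mult)
  have "k \<otimes> j = j\<^sup>\<star>"
    by (rule half[OF k j]) (simp_all add: ginv_Inv_mult le1 p q)
  moreover have "j \<otimes> k = k\<^sup>\<star>"
    by (rule half[OF j k]) (simp_all add: mult_ginv_Inv le1 p q)
  ultimately show ?thesis by (intro partial_unitI[of j k]) auto
qed

lemma boolean_inverse_monoid_Inv: "boolean_inverse_monoid (Inv S)"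
proof (intro boolean_inverse_monoid.intro boolean_inverse_monoid_axioms.intro inverse_monoid_Inv)
  obtain z where z: "is_zero S z" "z\<^sup>\<star> = z" using zero_projection by blast
  then have "z \<in> partial_units S" by (intro Proj_partial_units) (simp add: Proj_def is_zero_def)
  then show "\<exists>z. is_zero (Inv S) z" using z by (auto simp: is_zero_def partial_units_closed)
  have comp: "left_compatible S a b"
    if "a \<in> partial_units S" "b \<in> partial_units S" "compatible (Inv S) a b" for a b
    using that I.left_compatible_iff[of a b] left_compatible_Inv[of a b] by (simp add: compatible_def)
  show "\<exists>j. is_join (to_rr (Inv S)) {a, b} j"
    if "a \<in> carrier (Inv S)" "b \<in> carrier (Inv S)" and ab': "compatible (Inv S) a b" for a b
  proof -
    have ab: "a \<in> partial_units S" "b \<in> partial_units S" using that by simp_all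
    obtain j where j: "is_join S {a, b} j"
      using binary_join_exists[of a b] comp[OF ab ab'] ab partial_units_closed by blast
    then have "j \<in> partial_units S" using join_compatible_partial_units[OF ab ab'] by blast
    then show ?thesis using is_join_InvI[OF _ _ j] ab by blast
  qed
  show "is_join (to_rr (Inv S)) {a \<otimes>\<^bsub>Inv S\<^esub> c, b \<otimes>\<^bsub>Inv S\<^esub> c} (j \<otimes>\<^bsub>Inv S\<^esub> c)"
    if "a \<in> carrier (Inv S)" "b \<in> carrier (Inv S)" "c \<in> carrier (Inv S)"
      "is_join (to_rr (Inv S)) {a, b} j" for a b c j
    using that join_mult_right[of c a b j]
    by (simp add: is_join_Inv_iff partial_units_mult_closed partial_units_closed)
  show "is_join (to_rr (Inv S)) {c \<otimes>\<^bsub>Inv S\<^esub> a, c \<otimes>\<^bsub>Inv S\<^esub> b} (c \<otimes>\<^bsub>Inv S\<^esub> j)"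
    if "a \<in> carrier (Inv S)" "b \<in> carrier (Inv S)" "c \<in> carrier (Inv S)"
      "is_join (to_rr (Inv S)) {a, b} j" for a b c j
    using that join_mult_left[of c a b j]
    by (simp add: is_join_Inv_iff partial_units_mult_closed partial_units_closed)
  show "boolean_algebra_order ((nat_order (to_rr (Inv S)))\<lparr>carrier := idempotents (Inv S)\<rparr>)"
    using Proj_partial_units
    by (intro boolean_algebra_order_cong[OF Proj_boolean])
      (auto simp: idempotents_Inv below_Inv nat_order_def star_Inv)
qed

end

section \<open>The companion of the partial units\<close>

definition units_below :: "('a, 'm) rr_monoid_scheme \<Rightarrow> 'a \<Rightarrow> 'a set"
  where "units_below S s = {a \<in> partial_units S. a \<preceq>\<^bsub>S\<^esub> s}"

context right_restriction_monoid
begin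

lemma partial_units_mult_star:
  "\<lbrakk>f \<in> partial_units S; a \<in> carrier S\<rbrakk> \<Longrightarrow> f \<otimes> a\<^sup>\<star> \<in> partial_units S"
  using partial_units_mult_closed[OF _ Proj_partial_units[OF star_Proj]] by blast

lemma units_below_mult_star:
  assumes "f \<in> units_below S s" "a \<in> carrier S" "s \<in> carrier S"
  shows "f \<otimes> a\<^sup>\<star> \<in> units_below S s"
  using assms below_trans[of "f \<otimes> a\<^sup>\<star>" f s] mult_star_below[of f a]
  by (simp add: units_below_def partial_units_mult_star partial_units_closed star_closed)

lemma star_mem_units_below:
  "\<lbrakk>a \<in> units_below S s; s \<in> carrier S\<rbrakk> \<Longrightarrow> a\<^sup>\<star> \<in> units_below S (s\<^sup>\<star>)"
  by (auto simp: units_below_def partial_units_closed star_Proj star_mono intro: Proj_partial_units)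

end

context etale_boolean_rr_monoid
begin

interpretation I: boolean_inverse_monoid "Inv S"
  rewrites "carrier (Inv S) = partial_units S" and "mult (Inv S) = mult S" and "one (Inv S) = one S"
  by (simp_all add: boolean_inverse_monoid_Inv)

text \<open>Passage from joins in \<open>S\<close>, which need not be partial units, to joins in
  \<open>Inv S\<close>: a partial unit below \<open>s\<close> inherits a decomposition that lives in
  \<open>Inv S\<close>.\<close>

lemma below_join_of_partial_units:
  assumes F: "finite F" "F \<subseteq> partial_units S" "is_join S F s"
    and a: "a \<in> partial_units S" "a \<preceq> s"
  shows "is_join (to_rr (Inv S)) ((\<lambda>f. f \<otimes> a\<^sup>\<star>) ` F) a"
  using finite_join_below[OF F(1,3) a(2) partial_units_closed[OF a(1)]] F(1,2) a(1)
  by (auto simp: is_join_Inv_iff partial_units_closed intro!: partial_units_mult_star)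

lemma R_nu_contains_units_below_join:
  assumes X: "X \<in> carrier (R_nu_monoid (Inv S))" and F: "finite F" "F \<subseteq> X" "is_join S F s"
  shows "units_below S s \<subseteq> X"
proof
  fix a assume "a \<in> units_below S s"
  then have a: "a \<in> partial_units S" "a \<preceq> s" by (simp_all add: units_below_def)
  have FU: "F \<subseteq> partial_units S" using F(2) I.R_nu_subset[OF X] by blast
  have "f \<otimes> a\<^sup>\<star> \<in> X" if f: "f \<in> F" for f
  proof (rule I.R_nu_down_closed[OF X])
    show "f \<in> X" using f F(2) by blast
    have fu: "f \<in> partial_units S" using f FU by blast
    show fa: "f \<otimes> a\<^sup>\<star> \<in> partial_units S"
      using fu a(1) by (simp add: partial_units_mult_star partial_units_closed)
    show "f \<otimes> a\<^sup>\<star> \<preceq>\<^bsub>to_rr (Inv S)\<^esub> f"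
      using fu a(1) by (simp add: below_Inv[OF fa] mult_star_below partial_units_closed)
  qed
  then show "a \<in> X"
    using below_join_of_partial_units[OF F(1) FU F(3) a] F(1) by (intro I.R_nu_join_closed[OF X]) auto
qed

lemma units_below_in_R_nu:
  assumes "s \<in> carrier S"
  shows "units_below S s \<in> carrier (R_nu_monoid (Inv S))"
proof (rule I.R_nuI)
  show "units_below S s \<subseteq> partial_units S" by (auto simp: units_below_def)
  show "left_compatible (to_rr (Inv S)) x y" if "x \<in> units_below S s" "y \<in> units_below S s" for x y
    using that assms bounded_imp_left_compatible[of x s y]
    by (simp add: units_below_def left_compatible_Inv partial_units_closed)
  show "y \<in> units_below S s"
    if "x \<in> units_below S s" "y \<in> partial_units S" "y \<preceq>\<^bsub>to_rr (Inv S)\<^esub> x" for x y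
    using that assms below_trans[of y x s]
    by (simp add: units_below_def below_Inv partial_units_closed)
  show "j \<in> units_below S s"
    if F: "finite F" "F \<subseteq> units_below S s" "is_join (to_rr (Inv S)) F j" for F j
  proof -
    have "j \<in> partial_units S" "is_join S F j" using F by (simp_all add: is_join_Inv_iff)
    then show ?thesis
      using F(2) assms is_join_least[of F j s] by (auto simp: units_below_def subset_iff)
  qed
qed

lemma etale_units_below:
  assumes "s \<in> carrier S"
  shows "\<exists>F\<subseteq>units_below S s. finite F \<and> is_join S F s"
proof -
  obtain F where F: "finite F" "F \<subseteq> partial_units S" "is_join S F s" using etale[OF assms] by blast
  then have "F \<subseteq> units_below S s" using is_join_upper[OF F(3)] by (auto simp: units_below_def)
  then show ?thesis using F by blast
qed

text \<open>The generators are the partial units in an etale decomposition of \<open>s\<close>.\<close>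

lemma units_below_finite:
  assumes s: "s \<in> carrier S"
  shows "units_below S s \<in> carrier (Etale (Inv S))"
proof -
  obtain F where F: "F \<subseteq> units_below S s" "finite F" "is_join S F s"
    using etale_units_below[OF s] by blast
  then have "\<forall>Y\<in>carrier (R_nu_monoid (Inv S)). F \<subseteq> Y \<longrightarrow> units_below S s \<subseteq> Y"
    using R_nu_contains_units_below_join by simp
  then show ?thesis
    unfolding I.Etale_simps I.finite_elements_R_nu_iff
    using units_below_in_R_nu[OF s] F(1,2) by (intro conjI exI[of _ F])
qed

text \<open>If \<open>F\<close> and \<open>G\<close> decompose \<open>s\<close> and \<open>t\<close>, then the products \<open>f \<otimes> g\<close>
  decompose \<open>s \<otimes> t\<close>. A partial unit \<open>a\<close> below \<open>s \<otimes> t\<close> is thus a join of elements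
  \<open>f \<otimes> (g \<otimes> a\<^sup>\<star>)\<close>, each a product of a partial unit below \<open>s\<close> and one below
  \<open>t\<close>.\<close>

lemma units_below_mult:
  assumes s [simp]: "s \<in> carrier S" and t [simp]: "t \<in> carrier S"
  shows "units_below S s \<otimes>\<^bsub>Etale (Inv S)\<^esub> units_below S t = units_below S (s \<otimes> t)"
proof -
  let ?P = "units_below S s <#>\<^bsub>Inv S\<^esub> units_below S t"
  have P: "?P \<subseteq> units_below S (s \<otimes> t)"
    by (auto simp: set_mult_def units_below_def partial_units_closed
        intro: mult_mono_below partial_units_mult_closed)
  obtain F where F: "F \<subseteq> units_below S s" "finite F" "is_join S F s"
    using etale_units_below[OF s] by blast
  obtain G where G: "G \<subseteq> units_below S t" "finite G" "is_join S G t"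
    using etale_units_below[OF t] by blast
  let ?H = "\<Union>f\<in>F. (\<lambda>g. f \<otimes> g) ` G"
  have join: "is_join S ?H (s \<otimes> t)"
  proof (rule is_join_UN[of "\<lambda>f. f \<otimes> t"])
    show "is_join S ((\<lambda>f. f \<otimes> t) ` F) (s \<otimes> t)" using F by (intro finite_join_mult_right) auto
    show "is_join S ((\<lambda>g. f \<otimes> g) ` G) (f \<otimes> t)" if "f \<in> F" for f
      using G that is_join_subset[OF F(3)] by (intro finite_join_mult_left) auto
  qed
  have HU: "?H \<subseteq> partial_units S" using F(1) G(1) by (auto simp: units_below_def intro: partial_units_mult_closed)
  have "units_below S (s \<otimes> t) \<subseteq> nucleus (Inv S) ?P"
  proof
    fix a assume "a \<in> units_below S (s \<otimes> t)"
    then have a: "a \<in> partial_units S" "a \<preceq> s \<otimes> t" by (simp_all add: units_below_def)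
    have "f \<otimes> g \<otimes> a\<^sup>\<star> \<in> ?P" if "f \<in> F" "g \<in> G" for f g
    proof -
      have "g \<otimes> a\<^sup>\<star> \<in> units_below S t"
        using that G(1) a(1) by (intro units_below_mult_star) (auto simp: partial_units_closed)
      moreover have "f \<otimes> g \<otimes> a\<^sup>\<star> = f \<otimes> (g \<otimes> a\<^sup>\<star>)"
        using that F(3) G(3) is_join_subset a(1) by (intro m_assoc) (auto simp: partial_units_closed star_closed)
      ultimately show ?thesis using that F(1) by (auto simp: set_mult_def)
    qed
    then have "(\<lambda>h. h \<otimes> a\<^sup>\<star>) ` ?H \<subseteq> ?P" by blast
    then show "a \<in> nucleus (Inv S) ?P"
      using below_join_of_partial_units[OF _ HU join a] F(2) G(2) by (intro I.nucleusI) auto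
  qed
  moreover have "nucleus (Inv S) ?P \<subseteq> units_below S (s \<otimes> t)"
    using P by (intro I.nucleus_subset_R_nu units_below_in_R_nu) auto
  ultimately show ?thesis by (simp add: I.Etale_simps)
qed

text \<open>The domains of the elements that decompose \<open>s\<close> decompose \<open>s\<^sup>\<star>\<close>, because the star
  preserves finite joins; restricting them to the domain of \<open>a\<close> stays among the domains of
  partial units below \<open>s\<close>.\<close>

lemma units_below_star:
  assumes s [simp]: "s \<in> carrier S"
  shows "(units_below S s)\<^sup>\<star>\<^bsub>Etale (Inv S)\<^esub> = units_below S (s\<^sup>\<star>)"
proof -
  have st: "star (to_rr (Inv S)) ` units_below S s = star S ` units_below S s"
    by (intro image_cong) (simp_all add: units_below_def star_Inv)
  let ?P = "star S ` units_below S s"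
  have sc [simp]: "s\<^sup>\<star> \<in> carrier S" by (simp add: star_closed)
  note U = units_below_in_R_nu[OF sc]
  have P: "?P \<subseteq> units_below S (s\<^sup>\<star>)" by (auto intro: star_mem_units_below)
  obtain F where F: "F \<subseteq> units_below S s" "finite F" "is_join S F s"
    using etale_units_below[OF s] by blast
  have FU: "star S ` F \<subseteq> partial_units S" using F(1) P by (auto simp: units_below_def)
  have "units_below S (s\<^sup>\<star>) \<subseteq> nucleus (Inv S) ?P"
  proof
    fix a assume "a \<in> units_below S (s\<^sup>\<star>)"
    then have a: "a \<in> partial_units S" "a \<preceq> s\<^sup>\<star>" by (simp_all add: units_below_def)
    have "f\<^sup>\<star> \<otimes> a\<^sup>\<star> \<in> ?P" if f: "f \<in> F" for f
    proof -
      have ac: "a \<in> carrier S" using a(1) by (rule partial_units_closed)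
      then have "f \<otimes> a\<^sup>\<star> \<in> units_below S s" using f F(1) by (intro units_below_mult_star) auto
      moreover have "f\<^sup>\<star> \<otimes> a\<^sup>\<star> = (f \<otimes> a\<^sup>\<star>)\<^sup>\<star>"
        using f is_join_subset[OF F(3)] ac by (auto simp: star_mult_star)
      ultimately show ?thesis by simp
    qed
    then have "(\<lambda>h. h \<otimes> a\<^sup>\<star>) ` star S ` F \<subseteq> ?P" by blast
    then show "a \<in> nucleus (Inv S) ?P"
      using below_join_of_partial_units[OF _ FU finite_join_star[OF F(2,3)] a] F(2)
      by (intro I.nucleusI) auto
  qed
  moreover have "nucleus (Inv S) ?P \<subseteq> units_below S (s\<^sup>\<star>)"
    using P by (intro I.nucleus_subset_R_nu[OF U])
  ultimately show ?thesis by (simp add: I.Etale_simps st)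
qed

lemma inj_units_below: "inj_on (units_below S) (carrier S)"
proof (rule inj_onI)
  have le: "s \<preceq> t" if s: "s \<in> carrier S" and t: "t \<in> carrier S" and eq: "units_below S s = units_below S t" for s t
  proof -
    obtain F where F: "F \<subseteq> units_below S s" "is_join S F s" using etale_units_below[OF s] by blast
    show ?thesis by (rule is_join_least[OF F(2) t]) (use F(1) eq in \<open>auto simp: units_below_def\<close>)
  qed
  show "s = t" if "s \<in> carrier S" "t \<in> carrier S" "units_below S s = units_below S t" for s t
    using le[of s t] le[of t s] that by (intro below_antisym) auto
qed

text \<open>A finite generating set of \<open>X\<close> is left-compatible in \<open>S\<close> and so has a join there,
  although it need not have one in \<open>Inv S\<close>.\<close>

lemma surj_units_below:
  assumes X: "X \<in> carrier (Etale (Inv S))"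
  shows "\<exists>s\<in>carrier S. X = units_below S s"
proof -
  have Xn: "X \<in> carrier (R_nu_monoid (Inv S))"
    using X unfolding I.Etale_simps I.finite_elements_R_nu_iff by blast
  obtain F where F: "F \<subseteq> X" "finite F"
    and least: "\<forall>Y\<in>carrier (R_nu_monoid (Inv S)). F \<subseteq> Y \<longrightarrow> X \<subseteq> Y"
    using X unfolding I.Etale_simps I.finite_elements_R_nu_iff by blast
  have FU: "F \<subseteq> partial_units S" using F(1) I.R_nu_subset[OF Xn] by blast
  have lc: "left_compatible S x y" if "x \<in> F" "y \<in> F" for x y
    using I.R_nu_left_compatible[OF Xn, of x y] that F(1) FU left_compatible_Inv[of x y] by blast
  have "F \<subseteq> carrier S" using FU partial_units_closed by blast
  then obtain s where s: "is_join S F s" using left_compatible_finite_join[OF F(2)] lc by blast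
  have sc: "s \<in> carrier S" by (rule is_join_carrier[OF s])
  have "F \<subseteq> units_below S s" using is_join_upper[OF s] FU by (auto simp: units_below_def)
  then have "X \<subseteq> units_below S s" using least units_below_in_R_nu[OF sc] by simp
  moreover have "units_below S s \<subseteq> X" by (rule R_nu_contains_units_below_join[OF Xn F(2,1) s])
  ultimately show ?thesis using sc by blast
qed

lemma units_below_iso: "units_below S \<in> rr_iso S (Etale (Inv S))"
proof -
  have "units_below S \<in> hom S (Etale (Inv S))"
    by (rule homI) (simp_all add: units_below_finite units_below_mult)
  moreover have "bij_betw (units_below S) (carrier S) (carrier (Etale (Inv S)))"
    using inj_units_below units_below_finite surj_units_below by (auto simp: bij_betw_def)
  ultimately show ?thesis by (simp add: rr_iso_def iso_def units_below_star)
qed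

end

section \<open>Uniqueness\<close>

context right_restriction_monoid
begin

lemma rr_iso_partial_units:
  assumes h: "h \<in> rr_iso S T"
  shows "h ` partial_units S = partial_units T"
proof -
  have bij: "bij_betw h (carrier S) (carrier T)"
    and mult: "\<And>x y. \<lbrakk>x \<in> carrier S; y \<in> carrier S\<rbrakk> \<Longrightarrow> h (x \<otimes> y) = h x \<otimes>\<^bsub>T\<^esub> h y"
    and star: "\<And>x. x \<in> carrier S \<Longrightarrow> h (x\<^sup>\<star>) = (h x)\<^sup>\<star>\<^bsub>T\<^esub>"
    using h by (auto simp: rr_iso_def iso_def hom_def)
  have img: "h ` carrier S = carrier T" and inj: "inj_on h (carrier S)"
    using bij by (auto simp: bij_betw_def)
  have eq: "h b \<otimes>\<^bsub>T\<^esub> h a = (h a)\<^sup>\<star>\<^bsub>T\<^esub> \<longleftrightarrow> b \<otimes> a = a\<^sup>\<star>"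
    if "a \<in> carrier S" "b \<in> carrier S" for a b
    using that inj_on_eq_iff[OF inj, of "b \<otimes> a" "a\<^sup>\<star>"] by (simp add: mult star star_closed)
  have mem: "h a \<in> partial_units T \<longleftrightarrow> a \<in> partial_units S" if a: "a \<in> carrier S" for a
  proof -
    have "h a \<in> partial_units T \<longleftrightarrow>
        (\<exists>b\<in>carrier S. h b \<otimes>\<^bsub>T\<^esub> h a = (h a)\<^sup>\<star>\<^bsub>T\<^esub> \<and> h a \<otimes>\<^bsub>T\<^esub> h b = (h b)\<^sup>\<star>\<^bsub>T\<^esub>)"
      using a by (simp add: partial_units_def flip: img)
    then show ?thesis using a by (simp add: eq partial_units_def cong: bex_cong)
  qed
  have "partial_units T \<subseteq> h ` carrier S" unfolding img by (auto simp: partial_units_def)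
  then show ?thesis using mem partial_units_closed by blast
qed

lemma rr_iso_Inv:
  assumes h: "h \<in> rr_iso S T"
  shows "h \<in> iso (Inv S) (Inv T)"
proof -
  have "partial_units S \<subseteq> carrier S" by (auto simp: partial_units_def)
  then show ?thesis
    using h rr_iso_partial_units[OF h]
    by (auto simp: rr_iso_def iso_def hom_def bij_betw_def Pi_iff subset_iff intro: inj_on_subset)
qed

end

lemma inv_into_iso:
  assumes "monoid G" and h: "h \<in> iso G H"
  shows "inv_into (carrier G) h \<in> iso H G"
proof -
  interpret monoid G by fact
  have bij: "bij_betw h (carrier G) (carrier H)"
    and mult: "\<And>x y. \<lbrakk>x \<in> carrier G; y \<in> carrier G\<rbrakk> \<Longrightarrow> h (x \<otimes>\<^bsub>G\<^esub> y) = h x \<otimes>\<^bsub>H\<^esub> h y"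
    using h by (auto simp: iso_def hom_def)
  let ?k = "inv_into (carrier G) h"
  have kbij: "bij_betw ?k (carrier H) (carrier G)" by (rule bij_betw_inv_into[OF bij])
  have "?k (x \<otimes>\<^bsub>H\<^esub> y) = ?k x \<otimes>\<^bsub>G\<^esub> ?k y" if "x \<in> carrier H" "y \<in> carrier H" for x y
  proof -
    have k: "?k x \<in> carrier G" "?k y \<in> carrier G" using kbij that by (auto simp: bij_betw_def)
    have "h (?k x \<otimes>\<^bsub>G\<^esub> ?k y) = x \<otimes>\<^bsub>H\<^esub> y"
      using mult[OF k] bij that by (simp add: bij_betw_inv_into_right)
    then show ?thesis
      using bij_betw_inv_into_left[OF bij m_closed[OF k]] by simp
  qed
  then show ?thesis using kbij by (auto simp: iso_def hom_def bij_betw_def)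
qed

theorem theorem5p9:
  fixes S :: "'a rr_monoid"
  assumes "etale_boolean_rr_monoid S"
  shows "boolean_inverse_monoid (Inv S) \<and> S \<cong>\<^sub>r\<^sub>r Etale (Inv S) \<and>
    (\<forall>B :: 'b monoid. boolean_inverse_monoid B \<and> S \<cong>\<^sub>r\<^sub>r Etale B \<longrightarrow> B \<cong> Inv S)"
proof -
  interpret etale_boolean_rr_monoid S by fact
  have monoid_Inv: "monoid (Inv S)" using inverse_monoid_Inv by (rule inverse_monoid.axioms)
  have "B \<cong> Inv S" if B: "boolean_inverse_monoid B" and iso: "S \<cong>\<^sub>r\<^sub>r Etale B" for B :: "'b monoid"
  proof -
    obtain h where h: "h \<in> rr_iso S (Etale B)" using iso by (auto simp: rr_isomorphic_def)
    have "Inv (Etale B) \<cong> Inv S"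
      using inv_into_iso[OF monoid_Inv rr_iso_Inv[OF h]] by (rule is_isoI)
    moreover have "B \<cong> Inv (Etale B)"
      using boolean_inverse_monoid.ideal_below_iso[OF B] by (rule is_isoI)
    ultimately show ?thesis by (rule iso_trans[rotated])
  qed
  moreover have "S \<cong>\<^sub>r\<^sub>r Etale (Inv S)" using units_below_iso by (auto simp: rr_isomorphic_def)
  ultimately show ?thesis using boolean_inverse_monoid_Inv by blast
qed

end
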